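(* For every odd integer $m\ge 3$ there exists $V_m>\mathrm{vol}(S^{2m})$ such that for every $V\in(0,V_m]$ there is a non-spherical solution $u:\mathbb{R}^{2m}\to\mathbb{R}$ of $$(-\Delta)^m u=(2m-1)!\,e^{2mu}\quad\text{in }\mathbb{R}^{2m},\qquad \int_{\mathbb{R}^{2m}}e^{2mu(x)}\,dx=V;$$ that is, there exists a metric on $\mathbb{R}^{2m}$ of the form $g_u=e^{2u}|dx|^2$ (with $u$ non-spherical) satisfying $Q_{g_u}\equiv(2m-1)!$ and $\mathrm{vol}(g_u)=V$.
   Context: $\Delta$ is the Euclidean Laplacian, $|dx|^2$ the Euclidean metric, $S^{2m}$ the unit round sphere in $\mathbb{R}^{2m+1}$ and $\mathrm{vol}(S^{2m})$ its $2m$-dimensional volume. Solutions are understood in the classical (smooth) sense. A solution is called spherical if it is of the form $u_{x_0,\lambda}(x)=\log\frac{2\lambda}{1+\lambda^2|x-x_0|^2}$ for some $x_0\in\mathbb{R}^{2m}$ and $\lambda>0$; otherwise it is non-spherical. For $g_u=e^{2u}|dx|^2$ on $\mathbb{R}^{2m}$, the $Q$-curvature is $Q_{g_u}=e^{-2mu}(-\Delta)^m u$ and $\mathrm{vol}(g_u)=\int_{\mathbb{R}^{2m}}e^{2mu}\,dx$. *)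

theory Defs
  imports "HOL-Analysis.Analysis"
begin

definition partial :: "'n::finite \<Rightarrow> (real^'n \<Rightarrow> 'b::real_normed_vector) \<Rightarrow> real^'n \<Rightarrow> 'b" where
  "partial i f x = vector_derivative (\<lambda>t. f (x + t *\<^sub>R axis i 1)) (at 0)"

primrec Ck :: "nat \<Rightarrow> (real^'n::finite \<Rightarrow> real) \<Rightarrow> bool" where
  "Ck 0 f \<longleftrightarrow> continuous_on UNIV f"
| "Ck (Suc k) f \<longleftrightarrow> f differentiable_on UNIV \<and> (\<forall>i. Ck k (partial i f))"

definition smooth :: "(real^'n::finite \<Rightarrow> real) \<Rightarrow> bool" where
  "smooth f \<longleftrightarrow> (\<forall>k. Ck k f)"

definition laplacian :: "(real^'n::finite \<Rightarrow> real) \<Rightarrow> real^'n \<Rightarrow> real" where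
  "laplacian f x = (\<Sum>i\<in>UNIV. partial i (partial i f) x)"

definition neg_laplacian_pow :: "nat \<Rightarrow> (real^'n::finite \<Rightarrow> real) \<Rightarrow> real^'n \<Rightarrow> real" where
  "neg_laplacian_pow m = (\<lambda>f x. - laplacian f x) ^^ m"

text \<open>The next two notions refer to the metric with conformal factor \<open>exp (2 * u)\<close> on a
  Euclidean space of dimension \<open>2 * m\<close>; they are only meaningful if \<open>CARD('n) = 2 * m\<close>.\<close>

definition Q_curvature :: "nat \<Rightarrow> (real^'n::finite \<Rightarrow> real) \<Rightarrow> real^'n \<Rightarrow> real" where
  "Q_curvature m u x = exp (- 2 * real m * u x) * neg_laplacian_pow m u x"

definition conformal_volume :: "nat \<Rightarrow> (real^'n::finite \<Rightarrow> real) \<Rightarrow> ennreal" where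
  "conformal_volume m u = (\<integral>\<^sup>+x. ennreal (exp (2 * real m * u x)) \<partial>lborel)"

definition spherical_solution :: "real^'n::finite \<Rightarrow> real \<Rightarrow> real^'n \<Rightarrow> real" where
  "spherical_solution x0 l x = ln (2 * l / (1 + l\<^sup>2 * (norm (x - x0))\<^sup>2))"

definition spherical :: "(real^'n::finite \<Rightarrow> real) \<Rightarrow> bool" where
  "spherical u \<longleftrightarrow> (\<exists>x0 l. l > 0 \<and> u = spherical_solution x0 l)"

text \<open>Riemannian volume of an injectively parametrised submanifold: the square root of the
  determinant of the induced metric (first fundamental form), integrated over the parameters.\<close>

definition induced_metric ::
    "(real^'n::finite \<Rightarrow> 'b::real_inner) \<Rightarrow> real^'n \<Rightarrow> real^'n^'n" where
  "induced_metric \<phi> x = (\<chi> i j. partial i \<phi> x \<bullet> partial j \<phi> x)"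

definition parametrised_volume :: "(real^'n::finite \<Rightarrow> 'b::real_inner) \<Rightarrow> ennreal" where
  "parametrised_volume \<phi> = (\<integral>\<^sup>+x. ennreal (sqrt (det (induced_metric \<phi> x))) \<partial>lborel)"

text \<open>The unit sphere of dimension \<open>CARD('n)\<close> is \<open>sphere 0 1\<close> in the Euclidean space
  \<open>(real^'n) \<times> real\<close>. Inverse stereographic projection parametrises it bijectively up to the
  north pole \<open>(0, 1)\<close>, a null set, so that its parametrised volume is the volume of
  the whole sphere.\<close>

definition inv_stereographic :: "real^'n::finite \<Rightarrow> (real^'n) \<times> real" where
  "inv_stereographic x =
    ((2 / (1 + (norm x)\<^sup>2)) *\<^sub>R x, ((norm x)\<^sup>2 - 1) / (1 + (norm x)\<^sup>2))"

definition sphere_volume :: "'n::finite itself \<Rightarrow> ennreal" where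
  "sphere_volume _ = parametrised_volume (inv_stereographic :: real^'n \<Rightarrow> (real^'n) \<times> real)"

lemma one_plus_norm_sq_pos: "0 < 1 + (norm x)\<^sup>2"
  by (simp add: add_pos_nonneg)

lemma inj_inv_stereographic: "inj (inv_stereographic :: real^'n::finite \<Rightarrow> _)"
proof (rule injI)
  fix x y :: "real^'n"
  assume eq: "inv_stereographic x = inv_stereographic y"
  have p: "1 + (norm x)\<^sup>2 \<noteq> 0" "1 + (norm y)\<^sup>2 \<noteq> 0"
    using one_plus_norm_sq_pos[of x] one_plus_norm_sq_pos[of y] by simp_all
  from eq have "((norm x)\<^sup>2 - 1) / (1 + (norm x)\<^sup>2) = ((norm y)\<^sup>2 - 1) / (1 + (norm y)\<^sup>2)"
    by (simp add: inv_stereographic_def)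
  with p have "(norm x)\<^sup>2 = (norm y)\<^sup>2"
    by (simp add: frac_eq_eq algebra_simps)
  moreover from eq have "(2 / (1 + (norm x)\<^sup>2)) *\<^sub>R x = (2 / (1 + (norm y)\<^sup>2)) *\<^sub>R y"
    by (simp add: inv_stereographic_def)
  ultimately show "x = y" using p by simp
qed

lemma range_inv_stereographic:
  "range (inv_stereographic :: real^'n::finite \<Rightarrow> _) = sphere 0 1 - {(0, 1)}"
proof (intro equalityI subsetI)
  fix p :: "(real^'n) \<times> real"
  assume "p \<in> range inv_stereographic"
  then obtain x where x: "p = inv_stereographic x" by blast
  define s where "s = 1 + (norm x)\<^sup>2"
  have s: "s > 0" "(norm x)\<^sup>2 = s - 1"
    using one_plus_norm_sq_pos[of x] by (simp_all add: s_def)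
  have "(norm (fst p))\<^sup>2 + (snd p)\<^sup>2 = (2 / s)\<^sup>2 * (s - 1) + ((s - 2) / s)\<^sup>2"
    using s by (simp add: x inv_stereographic_def power_mult_distrib power_divide flip: s_def)
  also have "\<dots> = 1"
    using s by (simp add: field_simps power2_eq_square)
  finally have "norm p = 1" by (simp add: norm_prod_def)
  moreover have "snd p < 1"
    using s by (simp add: x inv_stereographic_def flip: s_def)
  ultimately show "p \<in> sphere 0 1 - {(0, 1)}" by auto
next
  fix p :: "(real^'n) \<times> real"
  assume p: "p \<in> sphere 0 1 - {(0, 1)}"
  obtain y t where yt: "p = (y, t)" by (cases p)
  have n: "(norm y)\<^sup>2 + t\<^sup>2 = 1" using p by (simp add: yt norm_prod_def)
  have "t \<noteq> 1" using p n by (auto simp: yt)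
  have ny: "(norm y)\<^sup>2 = (1 - t) * (1 + t)" using n by (simp add: algebra_simps power2_eq_square)
  define x where "x = (1 / (1 - t)) *\<^sub>R y"
  have nx: "(norm x)\<^sup>2 = (1 + t) / (1 - t)"
  proof -
    have "(norm x)\<^sup>2 = ((1 - t) * (1 + t)) / ((1 - t) * (1 - t))"
      by (simp add: x_def power_mult_distrib power_divide ny flip: power2_eq_square)
    then show ?thesis using \<open>t \<noteq> 1\<close> by simp
  qed
  have s: "1 + (norm x)\<^sup>2 = 2 / (1 - t)" using \<open>t \<noteq> 1\<close> by (simp add: nx field_simps)
  have "(2 / (1 + (norm x)\<^sup>2)) *\<^sub>R x = y"
    using \<open>t \<noteq> 1\<close> unfolding s by (simp add: x_def)
  moreover have "((norm x)\<^sup>2 - 1) / (1 + (norm x)\<^sup>2) = t"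
    using \<open>t \<noteq> 1\<close> unfolding s nx by (simp add: field_simps)
  ultimately have "p = inv_stereographic x" by (simp add: inv_stereographic_def yt)
  then show "p \<in> range inv_stereographic" by blast
qed

lemma partial_inv_stereographic:
  fixes x :: "real^'n::finite"
  defines "s \<equiv> 1 + (norm x)\<^sup>2"
  shows "partial i inv_stereographic x =
    ((2 / s) *\<^sub>R axis i 1 - (4 * x $ i / s\<^sup>2) *\<^sub>R x, 4 * x $ i / s\<^sup>2)"
proof -
  have s: "s > 0" "s \<noteq> 0" using one_plus_norm_sq_pos[of x] by (simp_all add: s_def)
  have nrm: "(norm (x + t *\<^sub>R axis i 1))\<^sup>2 = (norm x)\<^sup>2 + 2 * t * x $ i + t\<^sup>2" for t :: real
    unfolding power2_norm_eq_inner
    by (simp add: inner_add_left inner_add_right inner_axis inner_axis' inner_axis_axis power2_eq_square algebra_simps)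
  have q: "((\<lambda>t. c / (s + 2 * t * x $ i + t\<^sup>2)) has_real_derivative - 2 * c * x $ i / s\<^sup>2) (at 0)"
    for c :: real
    using s by (auto intro!: derivative_eq_intros simp: power2_eq_square)
  have "((\<lambda>t. ((2 / (s + 2 * t * x $ i + t\<^sup>2)) *\<^sub>R (x + t *\<^sub>R axis i 1),
            1 - 2 / (s + 2 * t * x $ i + t\<^sup>2)))
      has_vector_derivative
        ((2 / s) *\<^sub>R axis i 1 - (4 * x $ i / s\<^sup>2) *\<^sub>R x, 4 * x $ i / s\<^sup>2)) (at 0)"
    by (rule has_vector_derivative_Pair)
      (auto intro!: derivative_eq_intros q
         simp: s power2_eq_square has_real_derivative_iff_has_vector_derivative[symmetric])
  moreover have "inv_stereographic (x + t *\<^sub>R axis i 1) =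
      ((2 / (s + 2 * t * x $ i + t\<^sup>2)) *\<^sub>R (x + t *\<^sub>R axis i 1),
            1 - 2 / (s + 2 * t * x $ i + t\<^sup>2))" for t
  proof -
    have "1 + (norm (x + t *\<^sub>R axis i 1))\<^sup>2 \<noteq> 0"
      using one_plus_norm_sq_pos[of "x + t *\<^sub>R axis i 1"] by simp
    then have "s + 2 * t * x $ i + t\<^sup>2 \<noteq> 0" by (simp add: nrm s_def algebra_simps)
    then show ?thesis
      by (simp add: inv_stereographic_def nrm s_def field_simps)
  qed
  ultimately show ?thesis
    by (simp add: partial_def vector_derivative_at)
qed

lemma induced_metric_inv_stereographic:
  fixes x :: "real^'n::finite"
  shows "induced_metric inv_stereographic x = mat ((2 / (1 + (norm x)\<^sup>2))\<^sup>2)"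
proof -
  define s where "s = 1 + (norm x)\<^sup>2"
  have s: "s > 0" "x \<bullet> x = s - 1"
    using one_plus_norm_sq_pos[of x] by (simp_all add: s_def power2_norm_eq_inner)
  have "partial i inv_stereographic x \<bullet> partial j inv_stereographic x =
      (if i = j then (2 / s)\<^sup>2 else 0)" for i j
  proof -
    define d :: real where "d = (if i = j then 1 else 0)"
    have d: "axis i 1 \<bullet> (axis j 1 :: real^'n) = d"
      by (simp add: d_def inner_axis_axis)
    have "partial i inv_stereographic x \<bullet> partial j inv_stereographic x =
        (2 / s) * (2 / s) * d - (2 / s) * (4 * x $ j / s\<^sup>2) * x $ i
        - (4 * x $ i / s\<^sup>2) * (2 / s) * x $ j
        + (4 * x $ i / s\<^sup>2) * (4 * x $ j / s\<^sup>2) * (x \<bullet> x)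
        + (4 * x $ i / s\<^sup>2) * (4 * x $ j / s\<^sup>2)"
      unfolding partial_inv_stereographic s_def[symmetric] inner_Pair
        inner_diff_left inner_diff_right inner_scaleR_left inner_scaleR_right d
      by (simp add: inner_axis inner_axis' algebra_simps)
    also have "\<dots> = (2 / s)\<^sup>2 * d"
      using s(1) unfolding s(2) by (simp add: divide_simps) (simp add: power2_eq_square power4_eq_xxxx algebra_simps)
    finally show ?thesis by (simp add: d_def)
  qed
  then show ?thesis
    by (simp add: induced_metric_def mat_def vec_eq_iff s_def)
qed

end

theory Submission
  imports Defs
begin

text \<open>The solutions are radial, \<open>u x = f (|x|\<^sup>2)\<close> with \<open>f s = t * s - |t| - h t s\<close> for a real
  parameter \<open>t\<close>, where \<open>h t\<close> is the \<open>m\<close>-fold radial inverse Laplacian of \<open>(2m - 1)! exp (2 m f)\<close>;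
  since \<open>m\<close> is odd, this is the equation. As \<open>h \<ge> 0\<close>, the nonlinearity stays below
  \<open>(2m - 1)! exp (2 m (t * s - |t|))\<close>, so the solution is global. Moreover \<open>h t s\<close> grows at least
  like \<open>s ^ (m - 1)\<close>, which for \<open>m \<ge> 3\<close> beats the linear term whatever the sign of \<open>t\<close>. Hence the
  volume is finite and continuous in \<open>t\<close>. It tends to \<open>0\<close> as \<open>t \<rightarrow> -\<infinity>\<close>, because then
  \<open>f s \<le> - |t| (1 + s)\<close>. It is unbounded as \<open>t \<rightarrow> \<infinity>\<close>: a bound on the volume would bound \<open>h\<close> on
  \<open>[0, 3]\<close> independently of \<open>t\<close>, while \<open>t * s - t \<ge> t\<close> for \<open>s \<ge> 2\<close>. By the intermediate value theorem
  every positive volume is attained. A spherical solution decays only logarithmically, so none of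
  these solutions is spherical.\<close>

section \<open>The radial inverse Laplacian\<close>

text \<open>For \<open>s \<ge> 0\<close>, \<open>s ^ (k + 1) * avg k g s\<close> is the integral of
  \<open>\<sigma> ^ k * g \<sigma>\<close> over \<open>{0..s}\<close>. The rescaling to the fixed
  interval \<open>{0..1}\<close> keeps the expression regular at \<open>s = 0\<close> and allows
  differentiation under the integral sign.\<close>

definition avg :: "nat \<Rightarrow> (real \<Rightarrow> real) \<Rightarrow> real \<Rightarrow> real" where
  "avg k g s = integral {0..1} (\<lambda>\<theta>. \<theta> ^ k * g (\<theta> * s))"

text \<open>In the variable \<open>s = |x|\<^sup>2\<close> the Laplacian of \<open>f (|x|\<^sup>2)\<close> in dimension \<open>2m\<close> is
  \<open>4 (s f'' + m f')\<close>. Solving \<open>4 (s f'' + m f') = g\<close> with \<open>f 0 = 0\<close> and \<open>f\<close> regular at \<open>0\<close> gives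
  \<open>f' = avg (m - 1) g / 4\<close>, and \<open>s * avg 0 f' s\<close> is the integral of \<open>f'\<close> over \<open>[0, s]\<close>.\<close>

definition inv_lap :: "nat \<Rightarrow> (real \<Rightarrow> real) \<Rightarrow> real \<Rightarrow> real" where
  "inv_lap m g s = s / 4 * avg 0 (avg (m - 1) g) s"

section \<open>Joint continuity in parameter and argument\<close>

lemma continuous_on_avg_param:
  assumes "continuous_on (S \<times> {0..}) (\<lambda>(t, s). F t s)"
  shows "continuous_on (S \<times> {0..}) (\<lambda>(t, s). avg k (F t) s)"
proof -
  have "continuous_on ((S \<times> {0..}) \<times> cbox 0 1) (\<lambda>(p, \<theta>::real). \<theta> ^ k * F (fst p) (\<theta> * snd p))"
  proof -
    have "continuous_on ((S \<times> {0..}) \<times> cbox 0 1) (\<lambda>z. (\<lambda>(t, s). F t s) (fst (fst z), snd z * snd (fst z)))"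
      by (rule continuous_on_compose2[OF assms]) (auto intro!: continuous_intros)
    then show ?thesis
      by (auto intro!: continuous_intros simp: case_prod_beta)
  qed
  from integral_continuous_on_param[OF this] show ?thesis
    by (simp add: avg_def case_prod_beta)
qed

lemma continuous_on_inv_lap_param:
  assumes "continuous_on (S \<times> {0..}) (\<lambda>(t, s). F t s)"
  shows "continuous_on (S \<times> {0..}) (\<lambda>(t, s). inv_lap m (F t) s)"
  using continuous_on_avg_param[OF continuous_on_avg_param[OF assms], of 0 "m - 1"]
  by (auto intro!: continuous_intros simp: inv_lap_def case_prod_beta)

lemma continuous_on_inv_lap_pow_param:
  assumes "continuous_on (S \<times> {0..}) (\<lambda>(t, s). F t s)"
  shows "continuous_on (S \<times> {0..}) (\<lambda>(t, s). (inv_lap m ^^ k) (F t) s)"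
proof (induction k)
  case (Suc k)
  from continuous_on_inv_lap_param[OF this] show ?case by simp
qed (use assms in simp)

text \<open>A singleton parameter set specialises the parametrised continuity results to functions
  of one variable.\<close>

lemma continuous_on_pair_slice:
  fixes g :: "real \<Rightarrow> real"
  shows "continuous_on ({0::real} \<times> {0..}) (\<lambda>(t, s). g s) \<longleftrightarrow> continuous_on {0..} g"
proof
  assume "continuous_on ({0::real} \<times> {0..}) (\<lambda>(t, s). g s)"
  from continuous_on_compose2[OF this, of "{0..}" "\<lambda>s. (0, s)"]
  show "continuous_on {0..} g" by (auto simp: continuous_on_Pair)
next
  assume "continuous_on {0..} g"
  from continuous_on_compose2[OF this, of "{0::real} \<times> {0..}" snd]
  show "continuous_on ({0::real} \<times> {0..}) (\<lambda>(t, s). g s)"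
    unfolding case_prod_beta by (rule meta_mp) (auto intro!: continuous_intros)
qed

lemma continuous_on_avg: "continuous_on {0..} g \<Longrightarrow> continuous_on {0..} (avg k g)"
  using continuous_on_avg_param[of "{0::real}" "\<lambda>_. g" k] by (simp add: continuous_on_pair_slice)

lemma continuous_on_inv_lap: "continuous_on {0..} g \<Longrightarrow> continuous_on {0..} (inv_lap m g)"
  using continuous_on_inv_lap_param[of "{0::real}" "\<lambda>_. g" m] by (simp add: continuous_on_pair_slice)

lemma continuous_on_inv_lap_pow: "continuous_on {0..} g \<Longrightarrow> continuous_on {0..} ((inv_lap m ^^ k) g)"
  by (induction k) (auto intro: continuous_on_inv_lap)

section \<open>Monotonicity and linearity of the averages and of the inverse Laplacian\<close>

lemma avg_integrable:
  fixes g :: "real \<Rightarrow> real"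
  assumes "continuous_on {0..} g" "0 \<le> s"
  shows "(\<lambda>\<theta>. \<theta> ^ k * g (\<theta> * s)) integrable_on {0..1}"
proof (rule integrable_continuous_real)
  show "continuous_on {0..1} (\<lambda>\<theta>. \<theta> ^ k * g (\<theta> * s))"
    by (intro continuous_intros continuous_on_compose2[OF assms(1)]) (use assms(2) in auto)
qed

lemma avg_mono:
  assumes "continuous_on {0..} f" "continuous_on {0..} g" "0 \<le> s"
    and "\<And>\<sigma>. 0 \<le> \<sigma> \<Longrightarrow> \<sigma> \<le> s \<Longrightarrow> f \<sigma> \<le> g \<sigma>"
  shows "avg k f s \<le> avg k g s"
  unfolding avg_def using assms
  by (intro integral_le avg_integrable mult_left_mono) (auto simp: mult_left_le_one_le)

lemma inv_lap_mono:
  assumes "continuous_on {0..} f" "continuous_on {0..} g" "0 \<le> s"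
    and "\<And>\<sigma>. 0 \<le> \<sigma> \<Longrightarrow> \<sigma> \<le> s \<Longrightarrow> f \<sigma> \<le> g \<sigma>"
  shows "inv_lap m f s \<le> inv_lap m g s"
  unfolding inv_lap_def using assms
  by (intro mult_left_mono avg_mono continuous_on_avg) auto

lemma inv_lap_pow_mono:
  assumes "continuous_on {0..} f" "continuous_on {0..} g" "0 \<le> s"
    and "\<And>\<sigma>. 0 \<le> \<sigma> \<Longrightarrow> \<sigma> \<le> s \<Longrightarrow> f \<sigma> \<le> g \<sigma>"
  shows "(inv_lap m ^^ k) f s \<le> (inv_lap m ^^ k) g s"
  using assms(3,4)
proof (induction k arbitrary: s)
  case (Suc k)
  then show ?case
    by (auto intro!: inv_lap_mono continuous_on_inv_lap_pow assms(1,2))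
qed simp

lemma avg_add:
  assumes "continuous_on {0..} f" "continuous_on {0..} g" "0 \<le> s"
  shows "avg k (\<lambda>s. f s + g s) s = avg k f s + avg k g s"
  unfolding avg_def using assms
  by (subst integral_add[symmetric]) (auto intro!: avg_integrable simp: algebra_simps)

lemma avg_cmult: "avg k (\<lambda>s. c * g s) s = c * avg k g s"
  unfolding avg_def by (simp add: mult.left_commute)

lemma avg_cong: "0 \<le> s \<Longrightarrow> (\<And>\<sigma>. 0 \<le> \<sigma> \<Longrightarrow> f \<sigma> = g \<sigma>) \<Longrightarrow> avg k f s = avg k g s"
  unfolding avg_def by (intro integral_cong) auto

lemma inv_lap_cong:
  "0 \<le> s \<Longrightarrow> (\<And>\<sigma>. 0 \<le> \<sigma> \<Longrightarrow> f \<sigma> = g \<sigma>) \<Longrightarrow> inv_lap m f s = inv_lap m g s"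
  unfolding inv_lap_def by (simp cong: avg_cong)

lemma inv_lap_add:
  assumes "continuous_on {0..} f" "continuous_on {0..} g" "0 \<le> s"
  shows "inv_lap m (\<lambda>s. f s + g s) s = inv_lap m f s + inv_lap m g s"
proof -
  have "avg 0 (avg (m - 1) (\<lambda>s. f s + g s)) s = avg 0 (\<lambda>s. avg (m - 1) f s + avg (m - 1) g s) s"
    by (intro avg_cong avg_add assms)
  also have "\<dots> = avg 0 (avg (m - 1) f) s + avg 0 (avg (m - 1) g) s"
    by (intro avg_add continuous_on_avg assms)
  finally show ?thesis by (simp add: inv_lap_def algebra_simps)
qed

lemma inv_lap_cmult: "inv_lap m (\<lambda>s. c * g s) s = c * inv_lap m g s"
  by (simp add: inv_lap_def avg_cmult[abs_def])

lemma inv_lap_pow_cong: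
  "0 \<le> s \<Longrightarrow> (\<And>\<sigma>. 0 \<le> \<sigma> \<Longrightarrow> f \<sigma> = g \<sigma>) \<Longrightarrow> (inv_lap m ^^ k) f s = (inv_lap m ^^ k) g s"
  by (induction k arbitrary: s) (auto intro!: inv_lap_cong)

lemma inv_lap_pow_add:
  assumes "continuous_on {0..} f" "continuous_on {0..} g" "0 \<le> s"
  shows "(inv_lap m ^^ k) (\<lambda>s. f s + g s) s = (inv_lap m ^^ k) f s + (inv_lap m ^^ k) g s"
  using assms(3)
proof (induction k arbitrary: s)
  case (Suc k)
  have "inv_lap m ((inv_lap m ^^ k) (\<lambda>s. f s + g s)) s
      = inv_lap m (\<lambda>s. (inv_lap m ^^ k) f s + (inv_lap m ^^ k) g s) s"
    using Suc by (intro inv_lap_cong) auto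
  also have "\<dots> = inv_lap m ((inv_lap m ^^ k) f) s + inv_lap m ((inv_lap m ^^ k) g) s"
    by (intro inv_lap_add continuous_on_inv_lap_pow assms Suc)
  finally show ?case by simp
qed simp

lemma inv_lap_pow_cmult: "(inv_lap m ^^ k) (\<lambda>s. c * g s) = (\<lambda>s. c * (inv_lap m ^^ k) g s)"
  by (induction k) (auto simp: inv_lap_cmult)

lemma avg_zero [simp]: "avg k (\<lambda>_. 0) s = 0"
  by (simp add: avg_def)

lemma inv_lap_pow_zero [simp]: "(inv_lap m ^^ k) (\<lambda>_. 0) = (\<lambda>_. 0)"
  by (induction k) (auto simp: inv_lap_def avg_zero[abs_def])

lemma inv_lap_pow_nonneg:
  assumes "continuous_on {0..} g" "0 \<le> s" "\<And>\<sigma>. 0 \<le> \<sigma> \<Longrightarrow> \<sigma> \<le> s \<Longrightarrow> 0 \<le> g \<sigma>"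
  shows "0 \<le> (inv_lap m ^^ k) g s"
  using inv_lap_pow_mono[OF continuous_on_const assms(1,2), of 0 k m] assms(3) by simp

lemma avg_const: "avg k (\<lambda>_. c) s = c / (real k + 1)"
proof -
  have "((\<lambda>\<theta>. c * \<theta> ^ k) has_integral c * (1 ^ Suc k / real (Suc k) - 0 ^ Suc k / real (Suc k))) {0..1}"
    by (intro has_integral_mult_right fundamental_theorem_of_calculus)
      (auto intro!: derivative_eq_intros
         simp: has_real_derivative_iff_has_vector_derivative[symmetric] simp del: of_nat_Suc power_Suc)
  then show ?thesis
    unfolding avg_def by (subst mult.commute) (auto dest!: integral_unique simp: add.commute)
qed

lemma inv_lap_const: "m \<ge> 1 \<Longrightarrow> inv_lap m (\<lambda>_. c) s = c * s / (4 * real m)"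
  by (simp add: inv_lap_def avg_const[abs_def] avg_const of_nat_diff)

section \<open>Differentiating averages\<close>

lemma mult_avg_0_eq_integral:
  assumes "continuous_on {0..} g" "0 \<le> s"
  shows "s * avg 0 g s = integral {0..s} g"
proof (cases "s = 0")
  case False
  then have s: "s > 0" using assms by simp
  have "g integrable_on {0..s}"
    by (intro integrable_continuous_real continuous_on_subset[OF assms(1)]) auto
  then have "(g has_integral integral {0..s} g) {0..s}" by blast
  from has_integral_affinity[OF this[folded box_real], of s 0] s
  have "((\<lambda>x. g (s * x)) has_integral integral {0..s} g / s) ((\<lambda>x. x / s) ` {0..s})"
    by (simp add: field_simps)
  moreover have "(\<lambda>x. x / s) ` {0..s} = {0..1}"
    using s image_divide_atLeastAtMost[of s 0 s] by (auto simp: field_simps)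
  ultimately show ?thesis
    using s by (auto simp: avg_def mult.commute dest!: integral_unique)
qed simp

lemma has_derivative_integral_atLeast:
  fixes g :: "real \<Rightarrow> real"
  assumes "continuous_on {0..} g" "0 \<le> s"
  shows "((\<lambda>s. integral {0..s} g) has_real_derivative g s) (at s within {0..})"
proof -
  have "((\<lambda>s. integral {0..s} g) has_real_derivative g s) (at s within {0..s+1})"
    using assms by (intro integral_has_real_derivative continuous_on_subset[OF assms(1)]) auto
  moreover have "at s within {0..s+1} = at s within {0..}"
    by (rule at_within_nhd[of _ "{..<s+1}"]) auto
  ultimately show ?thesis by simp
qed

lemma has_derivative_inv_lap:
  assumes "continuous_on {0..} g" "0 \<le> s"
  shows "(inv_lap m g has_real_derivative avg (m - 1) g s / 4) (at s within {0..})"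
proof (rule has_field_derivative_transform_within[OF _ zero_less_one])
  show "((\<lambda>s. integral {0..s} (avg (m - 1) g) / 4) has_real_derivative avg (m - 1) g s / 4) (at s within {0..})"
    by (intro DERIV_cdivide has_derivative_integral_atLeast continuous_on_avg assms)
  show "integral {0..x} (avg (m - 1) g) / 4 = inv_lap m g x" if "x \<in> {0..}" for x
    using mult_avg_0_eq_integral[OF continuous_on_avg[OF assms(1)], of x "m - 1"] that
    by (simp add: inv_lap_def)
qed (use assms in auto)

text \<open>Differentiating \<open>g (\<theta> * s)\<close> in \<open>s\<close> produces a factor
  \<open>\<theta>\<close>, which raises the exponent of the averaging weight by one.\<close>

lemma has_derivative_avg:
  assumes "\<And>s. 0 \<le> s \<Longrightarrow> (g has_real_derivative g' s) (at s within {0..})"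
    and "continuous_on {0..} g'" "0 \<le> s"
  shows "(avg k g has_real_derivative avg (Suc k) g' s) (at s within {0..})"
proof -
  have cg: "continuous_on {0..} g"
    using assms(1) by (auto intro!: DERIV_continuous_on)
  have "((\<lambda>s. integral (cbox 0 1) (\<lambda>\<theta>. \<theta> ^ k * g (\<theta> * s))) has_real_derivative
      integral (cbox 0 1) (\<lambda>\<theta>. \<theta> ^ Suc k * g' (\<theta> * s))) (at s within {0..})"
  proof (rule leibniz_rule_field_derivative)
    fix s \<theta> :: real assume *: "s \<in> {0..}" "\<theta> \<in> cbox 0 1"
    have "((\<lambda>x. g (\<theta> * x)) has_real_derivative g' (\<theta> * s) * \<theta>) (at s within {0..})"
    proof -
      have "(g has_real_derivative g' (\<theta> * s)) (at (\<theta> * s) within ((*) \<theta> ` {0..}))"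
        using * by (intro DERIV_subset[OF assms(1)]) auto
      from DERIV_image_chain[OF this, of \<theta>] show ?thesis
        by (auto simp: o_def intro!: derivative_eq_intros)
    qed
    then show "((\<lambda>s. \<theta> ^ k * g (\<theta> * s)) has_real_derivative \<theta> ^ Suc k * g' (\<theta> * s)) (at s within {0..})"
      by (auto intro!: derivative_eq_intros)
  next
    show "continuous_on ({0..} \<times> cbox 0 1) (\<lambda>(x, t). t ^ Suc k * g' (t * x))"
      by (auto intro!: continuous_intros continuous_on_compose2[OF assms(2)] simp: case_prod_beta simp del: power_Suc)
  qed (use cg assms(3) in \<open>auto intro: avg_integrable\<close>)
  then show ?thesis by (simp add: avg_def[abs_def])
qed

text \<open>Integrate the derivative of \<open>\<theta> ^ Suc k * g (\<theta> * s)\<close> over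
  \<open>{0..1}\<close>. For \<open>k = m - 1\<close> this is the radial Poisson equation satisfied
  by \<open>inv_lap m g\<close>.\<close>

lemma avg_Suc_deriv:
  assumes "\<And>s. 0 \<le> s \<Longrightarrow> (g has_real_derivative g' s) (at s within {0..})"
    and "continuous_on {0..} g'" "0 \<le> s"
  shows "s * avg (Suc k) g' s = g s - (real k + 1) * avg k g s"
proof -
  have cg: "continuous_on {0..} g"
    using assms(1) by (auto intro!: DERIV_continuous_on)
  have "((\<lambda>\<theta>. (real k + 1) * (\<theta> ^ k * g (\<theta> * s)) + s * (\<theta> ^ Suc k * g' (\<theta> * s))) has_integral
      1 ^ Suc k * g (1 * s) - 0 ^ Suc k * g (0 * s)) {0..1}"
  proof (rule fundamental_theorem_of_calculus)
    fix \<theta> :: real assume *: "\<theta> \<in> {0..1}"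
    have "((\<lambda>x. g (x * s)) has_real_derivative g' (\<theta> * s) * s) (at \<theta> within {0..1})"
    proof -
      have "(g has_real_derivative g' (\<theta> * s)) (at (\<theta> * s) within ((\<lambda>x. x * s) ` {0..1}))"
        using * assms(3) by (intro DERIV_subset[OF assms(1)]) auto
      from DERIV_image_chain[OF this, of s] show ?thesis
        unfolding o_def by (rule meta_mp) (auto intro!: derivative_eq_intros)
    qed
    note D = this
    have "((\<lambda>x. x ^ Suc k * g (x * s)) has_real_derivative
       (real k + 1) * (\<theta> ^ k * g (\<theta> * s)) + s * (\<theta> ^ Suc k * g' (\<theta> * s))) (at \<theta> within {0..1})"
      by (rule derivative_eq_intros D refl)+ (simp add: algebra_simps)
    then show "((\<lambda>x. x ^ Suc k * g (x * s)) has_vector_derivative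
       (real k + 1) * (\<theta> ^ k * g (\<theta> * s)) + s * (\<theta> ^ Suc k * g' (\<theta> * s))) (at \<theta> within {0..1})"
      by (simp only: has_real_derivative_iff_has_vector_derivative)
  qed simp
  moreover have "((\<lambda>\<theta>. (real k + 1) * (\<theta> ^ k * g (\<theta> * s)) + s * (\<theta> ^ Suc k * g' (\<theta> * s))) has_integral
      (real k + 1) * avg k g s + s * avg (Suc k) g' s) {0..1}"
    unfolding avg_def
    by (intro has_integral_add has_integral_mult_right integrable_integral avg_integrable cg assms)
  ultimately have "1 ^ Suc k * g (1 * s) - 0 ^ Suc k * g (0 * s)
      = (real k + 1) * avg k g s + s * avg (Suc k) g' s"
    by (rule has_integral_unique)
  then show ?thesis by simp
qed

text \<open>Radial profiles live on \<open>[0, \<infinity>)\<close>; one-sided derivatives at \<open>0\<close> suffice for smoothness on the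
  whole space, because \<open>|x|\<^sup>2\<close> only takes values in this half-line.\<close>

primrec Dk :: "nat \<Rightarrow> (real \<Rightarrow> real) \<Rightarrow> bool" where
  "Dk 0 f \<longleftrightarrow> continuous_on {0..} f"
| "Dk (Suc k) f \<longleftrightarrow> (\<exists>f'. (\<forall>s\<ge>0. (f has_real_derivative f' s) (at s within {0..})) \<and> Dk k f')"

section \<open>Closure properties of differentiable profiles on the half-line\<close>

lemma Dk_Suc_imp: "Dk (Suc k) f \<Longrightarrow> Dk k f"
proof (induction k arbitrary: f)
  case 0
  then obtain f' where "\<forall>s\<ge>0. (f has_real_derivative f' s) (at s within {0..})" by auto
  then show ?case by (auto intro: DERIV_continuous_on)
next
  case (Suc k)
  then show ?case by (metis Dk.simps(2))
qed

lemma Dk_imp_continuous_on: "Dk k f \<Longrightarrow> continuous_on {0..} f"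
proof (induction k)
  case (Suc k)
  then show ?case by (blast dest: Dk_Suc_imp)
qed simp

lemma Dk_const: "Dk k (\<lambda>_. c)"
proof (induction k arbitrary: c)
  case (Suc k)
  show ?case using Suc[of 0] by (auto intro!: exI[of _ "\<lambda>_. 0"] derivative_eq_intros)
qed simp

lemma Dk_id: "Dk k (\<lambda>x. x)"
  by (cases k) (auto intro!: exI[of _ "\<lambda>_. 1"] derivative_eq_intros Dk_const continuous_intros)

lemma Dk_add: "Dk k f \<Longrightarrow> Dk k g \<Longrightarrow> Dk k (\<lambda>s. f s + g s)"
proof (induction k arbitrary: f g)
  case (Suc k)
  then obtain f' g' where "\<forall>s\<ge>0. (f has_real_derivative f' s) (at s within {0..})" "Dk k f'"
     "\<forall>s\<ge>0. (g has_real_derivative g' s) (at s within {0..})" "Dk k g'" by auto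
  with Suc.IH show ?case
    by (auto intro!: exI[of _ "\<lambda>s. f' s + g' s"] derivative_eq_intros)
qed (auto intro!: continuous_intros)

lemma Dk_mult: "Dk k f \<Longrightarrow> Dk k g \<Longrightarrow> Dk k (\<lambda>s. f s * g s)"
proof (induction k arbitrary: f g)
  case (Suc k)
  then obtain f' g' where *: "\<forall>s\<ge>0. (f has_real_derivative f' s) (at s within {0..})" "Dk k f'"
     "\<forall>s\<ge>0. (g has_real_derivative g' s) (at s within {0..})" "Dk k g'" by auto
  from Suc.prems have "Dk k f" "Dk k g" by (auto dest: Dk_Suc_imp simp del: Dk.simps)
  with Suc.IH * have "Dk k (\<lambda>s. f' s * g s + f s * g' s)"
    by (intro Dk_add) auto
  with * show ?case
    by (auto intro!: exI[of _ "\<lambda>s. f' s * g s + f s * g' s"] derivative_eq_intros)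
qed (auto intro!: continuous_intros)

lemma Dk_exp: "Dk k f \<Longrightarrow> Dk k (\<lambda>s. exp (f s))"
proof (induction k arbitrary: f)
  case (Suc k)
  then obtain f' where *: "\<forall>s\<ge>0. (f has_real_derivative f' s) (at s within {0..})" "Dk k f'" by auto
  from Suc.prems have "Dk k f" by (auto dest: Dk_Suc_imp simp del: Dk.simps)
  with Suc.IH * have "Dk k (\<lambda>s. exp (f s) * f' s)"
    by (intro Dk_mult) auto
  with * show ?case
    by (auto intro!: exI[of _ "\<lambda>s. exp (f s) * f' s"] derivative_eq_intros)
qed (auto intro!: continuous_intros)

lemma Dk_avg: "Dk k g \<Longrightarrow> Dk k (avg j g)"
proof (induction k arbitrary: g j)
  case (Suc k)
  then obtain g' where *: "\<forall>s\<ge>0. (g has_real_derivative g' s) (at s within {0..})" "Dk k g'" by auto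
  then show ?case
    using has_derivative_avg[of g g'] Suc.IH[of g' "Suc j"] Dk_imp_continuous_on[OF *(2)]
    by (auto intro!: exI[of _ "avg (Suc j) g'"])
qed (auto intro: continuous_on_avg)

text \<open>The derivative of \<open>inv_lap m g\<close> is a multiple of an average of
  \<open>g\<close>, hence as regular as \<open>g\<close>. This gain of one order drives the later
  bootstrapping.\<close>

lemma Dk_inv_lap: "Dk k g \<Longrightarrow> Dk (Suc k) (inv_lap m g)"
  using Dk_avg[of k g "m - 1"] has_derivative_inv_lap[OF Dk_imp_continuous_on]
  by (auto intro!: exI[of _ "\<lambda>s. avg (m - 1) g s * (1/4)"] Dk_mult Dk_const)

lemma Dk_inv_lap_pow: "Dk k g \<Longrightarrow> Dk k ((inv_lap m ^^ j) g)"
  by (induction j) (auto intro: Dk_Suc_imp Dk_inv_lap simp del: Dk.simps)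

lemma Dk_cong: "Dk k f \<Longrightarrow> (\<And>s. 0 \<le> s \<Longrightarrow> f s = g s) \<Longrightarrow> Dk k g"
proof (cases k)
  case (Suc j)
  assume "Dk k f" and eq: "\<And>s. 0 \<le> s \<Longrightarrow> f s = g s"
  then obtain f' where *: "\<forall>s\<ge>0. (f has_real_derivative f' s) (at s within {0..})" "Dk j f'"
    using Suc by auto
  have "(g has_real_derivative f' s) (at s within {0..})" if "s \<ge> 0" for s
    by (rule has_field_derivative_transform_within[of f _ _ _ 1]) (use * eq that in auto)
  with * show ?thesis using Suc by auto
qed (auto intro: continuous_on_eq)

section \<open>Radial functions\<close>

lemma partial_eqI:
  assumes "(f has_derivative f') (at x)"
  shows "partial i f x = f' (axis i 1)"
proof -
  have "((\<lambda>t. x + t *\<^sub>R axis i 1) has_derivative (\<lambda>t. t *\<^sub>R axis i 1)) (at (0::real))"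
    by (auto intro!: derivative_eq_intros)
  moreover have "(f has_derivative f') (at (x + 0 *\<^sub>R axis i 1))" using assms by simp
  ultimately have "((\<lambda>t. f (x + t *\<^sub>R axis i 1)) has_derivative (\<lambda>t. f' (t *\<^sub>R axis i 1))) (at 0)"
    by (rule has_derivative_compose)
  moreover have "f' (t *\<^sub>R axis i 1) = t *\<^sub>R f' (axis i 1)" for t
    using assms has_derivative_bounded_linear linear_cmul bounded_linear.linear by blast
  ultimately show ?thesis
    by (simp add: partial_def has_vector_derivative_def vector_derivative_at)
qed

lemma has_derivative_radial:
  fixes f :: "real \<Rightarrow> real" and x :: "real^'n"
  assumes "\<And>s. 0 \<le> s \<Longrightarrow> (f has_real_derivative f' s) (at s within {0..})"
  shows "((\<lambda>x. f ((norm x)\<^sup>2)) has_derivative (\<lambda>y. f' ((norm x)\<^sup>2) * (2 * (x \<bullet> y)))) (at x)"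
proof -
  have "((\<lambda>x. (norm x)\<^sup>2) has_derivative (\<lambda>y. 2 * (x \<bullet> y))) (at x)"
    unfolding power2_norm_eq_inner
    by (auto intro!: derivative_eq_intros simp: inner_commute)
  from has_derivative_in_compose2[of "{0..}" f "\<lambda>s y. f' s * y", OF _ _ _ this] assms
  show ?thesis by (simp add: has_field_derivative_def image_subset_iff)
qed

lemma partial_radial:
  fixes f :: "real \<Rightarrow> real"
  assumes "\<And>s. 0 \<le> s \<Longrightarrow> (f has_real_derivative f' s) (at s within {0..})"
  shows "partial i (\<lambda>x. f ((norm x)\<^sup>2)) = (\<lambda>x. 2 * x $ i * f' ((norm x)\<^sup>2))"
  using partial_eqI[OF has_derivative_radial[OF assms], of i] by (auto simp: inner_axis)

lemma laplacian_radial: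
  fixes f :: "real \<Rightarrow> real" and x :: "real^'n"
  assumes f: "\<And>s. 0 \<le> s \<Longrightarrow> (f has_real_derivative f' s) (at s within {0..})"
    and f': "\<And>s. 0 \<le> s \<Longrightarrow> (f' has_real_derivative f'' s) (at s within {0..})"
  shows "laplacian (\<lambda>x. f ((norm x)\<^sup>2)) x
    = 4 * (norm x)\<^sup>2 * f'' ((norm x)\<^sup>2) + 2 * real CARD('n) * f' ((norm x)\<^sup>2)"
proof -
  have "partial i (\<lambda>x. f' ((norm x)\<^sup>2) * (2 * x $ i)) x =
      4 * (x $ i)\<^sup>2 * f'' ((norm x)\<^sup>2) + 2 * f' ((norm x)\<^sup>2)" for i
  proof -
    have "((\<lambda>x. f' ((norm x)\<^sup>2) * (2 * x $ i)) has_derivative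
       (\<lambda>y. f' ((norm x)\<^sup>2) * (2 * y $ i) + (f'' ((norm x)\<^sup>2) * (2 * (x \<bullet> y))) * (2 * x $ i))) (at x)"
      by (rule has_derivative_mult[OF has_derivative_radial[OF f']])
        (assumption | rule has_derivative_mult_right bounded_linear_imp_has_derivative bounded_linear_vec_nth)+
    from partial_eqI[OF this, of i] show ?thesis
      by (simp add: inner_axis power2_eq_square)
  qed
  then have "laplacian (\<lambda>x. f ((norm x)\<^sup>2)) x =
      (\<Sum>i\<in>UNIV. 4 * (x $ i)\<^sup>2 * f'' ((norm x)\<^sup>2) + 2 * f' ((norm x)\<^sup>2))"
    unfolding laplacian_def by (simp add: partial_radial[OF f] mult.commute)
  also have "\<dots> = 4 * (\<Sum>i\<in>UNIV. (x $ i)\<^sup>2) * f'' ((norm x)\<^sup>2) + 2 * real CARD('n) * f' ((norm x)\<^sup>2)"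
    by (simp add: sum.distrib sum_distrib_left sum_distrib_right)
  also have "(\<Sum>i\<in>UNIV. (x $ i)\<^sup>2) = (norm x)\<^sup>2"
    unfolding power2_norm_eq_inner inner_vec_def by (simp add: power2_eq_square)
  finally show ?thesis .
qed

text \<open>The first two derivatives of the profile are \<open>avg (m - 1) g / 4\<close> and
  \<open>avg m g' / 4\<close>; in dimension \<open>2 * m\<close> the identity
  \<open>avg_Suc_deriv\<close> combines them to \<open>g\<close>. The constant \<open>c\<close>
  admits profiles that do not vanish at the origin.\<close>

lemma laplacian_inv_lap:
  fixes x :: "real^'n"
  assumes "Dk 1 g" "m \<ge> 1" "CARD('n) = 2 * m"
  shows "laplacian (\<lambda>x. c + inv_lap m g ((norm x)\<^sup>2)) x = g ((norm x)\<^sup>2)"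
proof -
  obtain g' where g': "\<And>s. 0 \<le> s \<Longrightarrow> (g has_real_derivative g' s) (at s within {0..})"
    "continuous_on {0..} g'" using assms(1) by auto
  have cg: "continuous_on {0..} g" using assms(1) by (rule Dk_imp_continuous_on)
  have "laplacian (\<lambda>x. c + inv_lap m g ((norm x)\<^sup>2)) x = 4 * (norm x)\<^sup>2 * (avg m g' ((norm x)\<^sup>2) / 4)
      + 2 * real CARD('n) * (avg (m - 1) g ((norm x)\<^sup>2) / 4)"
  proof (rule laplacian_radial[of "\<lambda>s. c + inv_lap m g s"])
    show "((\<lambda>s. c + inv_lap m g s) has_real_derivative avg (m - 1) g s / 4) (at s within {0..})"
      if "0 \<le> s" for s
      using has_derivative_inv_lap[OF cg that, of m] by (auto intro!: derivative_eq_intros)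
    show "((\<lambda>s. avg (m - 1) g s / 4) has_real_derivative avg m g' s / 4) (at s within {0..})"
      if "0 \<le> s" for s
      using has_derivative_avg[OF g' that, of "m - 1"] assms(2) by (auto intro!: derivative_eq_intros)
  qed
  also have "\<dots> = g ((norm x)\<^sup>2)"
    using avg_Suc_deriv[OF g', of "(norm x)\<^sup>2" "m - 1"] assms(2,3) by (simp add: of_nat_diff)
  finally show ?thesis .
qed

lemma neg_laplacian_pow_inv_lap:
  assumes "Dk 1 g" "m \<ge> 1" "CARD('n) = 2 * m"
  shows "neg_laplacian_pow k (\<lambda>x::real^'n. (inv_lap m ^^ k) g ((norm x)\<^sup>2))
    = (\<lambda>x. (- 1) ^ k * g ((norm x)\<^sup>2))"
  using assms(1)
proof (induction k arbitrary: g)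
  case 0
  then show ?case by (simp add: neg_laplacian_pow_def)
next
  case (Suc k)
  \<comment> \<open>The sign of each negated Laplacian is moved into the argument of
    \<open>inv_lap\<close> by linearity, so that the induction hypothesis applies with
    \<open>- g\<close> in place of \<open>g\<close>.\<close>
  have *: "(\<lambda>x::real^'n. - laplacian (\<lambda>x. (inv_lap m ^^ Suc k) g ((norm x)\<^sup>2)) x)
      = (\<lambda>x. (inv_lap m ^^ k) (\<lambda>s. (- 1) * g s) ((norm x)\<^sup>2))"
    using laplacian_inv_lap[OF Dk_inv_lap_pow[OF Suc.prems] assms(2,3), of 0 k m]
    unfolding inv_lap_pow_cmult by simp
  have "neg_laplacian_pow (Suc k) (\<lambda>x::real^'n. (inv_lap m ^^ Suc k) g ((norm x)\<^sup>2))
      = neg_laplacian_pow k (\<lambda>x::real^'n. - laplacian (\<lambda>x. (inv_lap m ^^ Suc k) g ((norm x)\<^sup>2)) x)"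
    unfolding neg_laplacian_pow_def funpow_Suc_right by simp
  also have "\<dots> = (\<lambda>x. (- 1) ^ k * (- 1 * g ((norm x)\<^sup>2)))"
    unfolding * by (rule Suc.IH) (intro Dk_mult Dk_const Suc.prems)
  finally show ?case by simp
qed

section \<open>Classical smoothness of radial functions\<close>

lemma Ck_Suc_imp: "Ck (Suc k) f \<Longrightarrow> Ck k f"
  by (induction k arbitrary: f) (auto intro: differentiable_imp_continuous_on)

lemma Ck_add: "Ck k f \<Longrightarrow> Ck k g \<Longrightarrow> Ck k (\<lambda>x. f x + g x)"
proof (induction k arbitrary: f g)
  case (Suc k)
  have "partial i (\<lambda>x. f x + g x) = (\<lambda>x. partial i f x + partial i g x)" for i
  proof
    fix x
    from Suc.prems obtain f' g' where d: "(f has_derivative f') (at x)" "(g has_derivative g') (at x)"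
      unfolding Ck.simps differentiable_on_def differentiable_def by (meson UNIV_I)
    show "partial i (\<lambda>x. f x + g x) x = partial i f x + partial i g x"
      using partial_eqI[OF has_derivative_add[OF d], of i] partial_eqI[OF d(1), of i]
        partial_eqI[OF d(2), of i] by simp
  qed
  with Suc show ?case by auto
qed (auto intro!: continuous_intros)

lemma Ck_mult: "Ck k f \<Longrightarrow> Ck k g \<Longrightarrow> Ck k (\<lambda>x. f x * g x)"
proof (induction k arbitrary: f g)
  case (Suc k)
  have eq: "partial i (\<lambda>x. f x * g x) = (\<lambda>x. f x * partial i g x + partial i f x * g x)" for i
  proof
    fix x
    from Suc.prems obtain f' g' where d: "(f has_derivative f') (at x)" "(g has_derivative g') (at x)"
      unfolding Ck.simps differentiable_on_def differentiable_def by (meson UNIV_I)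
    show "partial i (\<lambda>x. f x * g x) x = f x * partial i g x + partial i f x * g x"
      using partial_eqI[OF has_derivative_mult[OF d], of i] partial_eqI[OF d(1), of i]
        partial_eqI[OF d(2), of i] by simp
  qed
  from Suc.prems have "Ck k f" "Ck k g" by (auto dest: Ck_Suc_imp simp del: Ck.simps)
  with Suc show ?case
    unfolding Ck.simps eq by (auto intro!: Ck_add)
qed (auto intro!: continuous_intros)

lemma Ck_const: "Ck k (\<lambda>_::real^'n. c)"
proof (induction k arbitrary: c)
  case (Suc k)
  have "partial i (\<lambda>_::real^'n. c) = (\<lambda>_. 0)" for i
    using partial_eqI[OF has_derivative_const] by fast
  with Suc show ?case by auto
qed auto

lemma Ck_coordinate: "Ck k (\<lambda>x::real^'n. x $ i)"
proof (cases k)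
  case (Suc k)
  have d: "((\<lambda>x::real^'n. x $ i) has_derivative (\<lambda>x. x $ i)) (at x)" for x
    by (auto intro!: bounded_linear_imp_has_derivative bounded_linear_vec_nth)
  then have "partial j (\<lambda>x::real^'n. x $ i) = (\<lambda>_. axis j 1 $ i)" for j
    using partial_eqI[OF d] by fast
  then show ?thesis using Suc d
    by (auto simp: Ck_const differentiable_on_def differentiable_def)
qed (auto intro!: continuous_intros)

lemma Ck_radial: "Dk k f \<Longrightarrow> Ck k (\<lambda>x::real^'n. f ((norm x)\<^sup>2))"
proof (induction k arbitrary: f)
  case 0
  then show ?case
    by (auto intro!: continuous_intros intro: continuous_on_compose2[of "{0..}" f])
next
  case (Suc k)
  then obtain f' where f': "\<And>s. s \<ge> 0 \<Longrightarrow> (f has_real_derivative f' s) (at s within {0..})" "Dk k f'"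
    by auto
  have "(\<lambda>x::real^'n. f ((norm x)\<^sup>2)) differentiable_on UNIV"
    using has_derivative_radial[OF f'(1)] by (auto simp: differentiable_on_def differentiable_def)
  moreover have "Ck k (\<lambda>x::real^'n. 2 * x $ i * f' ((norm x)\<^sup>2))" for i
    by (intro Ck_mult Ck_const Ck_coordinate Suc.IH f')
  ultimately show ?case
    by (simp add: partial_radial[OF f'(1)])
qed

section \<open>Integrals of radial functions\<close>

lemma nn_integral_inverse_1_plus_square_finite:
  "(\<integral>\<^sup>+x. ennreal (1 / (1 + x\<^sup>2)) \<partial>lborel) < \<infinity>" (is "?I < _")
proof -
  have m: "(\<lambda>x::real. 1 / (1 + x\<^sup>2)) \<in> borel_measurable borel" by measurable
  have half: "(\<integral>\<^sup>+x. ennreal (1 / (1 + x\<^sup>2)) * indicator {0..} x \<partial>lborel) < \<infinity>" (is "?H < _")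
  proof -
    have "?H = ennreal (pi / 2 - arctan 0)"
    proof (rule nn_integral_FTC_atLeast[OF m])
      show "(arctan has_real_derivative 1 / (1 + x\<^sup>2)) (at x)" for x
        by (auto intro!: derivative_eq_intros simp: divide_inverse)
    qed (auto intro: tendsto_arctan_at_top)
    then show ?thesis by simp
  qed
  have "?I \<le> (\<integral>\<^sup>+x. ennreal (1 / (1 + x\<^sup>2)) * indicator {0..} x
       + ennreal (1 / (1 + (- x)\<^sup>2)) * indicator {0..} (- x) \<partial>lborel)"
    by (intro nn_integral_mono) (auto simp: indicator_def)
  also have "\<dots> = ?H + (\<integral>\<^sup>+x. ennreal (1 / (1 + (- x)\<^sup>2)) * indicator {0..} (- x) \<partial>lborel)"
    by (intro nn_integral_add) measurable
  also have "(\<integral>\<^sup>+x. ennreal (1 / (1 + (- x)\<^sup>2)) * indicator {0..} (- x) \<partial>lborel) = ?H"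
    using nn_integral_real_affine[of "\<lambda>x. ennreal (1 / (1 + x\<^sup>2)) * indicator {0..} x" "-1" 0]
    by simp
  finally show ?thesis using half by (auto intro: le_less_trans)
qed

text \<open>An integrable majorant in product form, so that its integral factors over the
  coordinates. It dominates both the Gaussian and the volume density of the sphere in stereographic
  coordinates, up to a constant.\<close>

definition cauchy_weight :: "'a::euclidean_space \<Rightarrow> real" where
  "cauchy_weight x = (\<Prod>b\<in>Basis. 1 / (1 + (x \<bullet> b)\<^sup>2))"

lemma cauchy_weight_measurable [measurable]: "cauchy_weight \<in> borel_measurable borel"
  unfolding cauchy_weight_def by measurable

lemma cauchy_weight_nonneg: "0 \<le> cauchy_weight x"
  unfolding cauchy_weight_def by (intro prod_nonneg) auto

lemma nn_integral_cauchy_weight_finite: "(\<integral>\<^sup>+x. ennreal (cauchy_weight (x::'a::euclidean_space)) \<partial>lborel) < \<infinity>"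
proof -
  have "(\<integral>\<^sup>+x. ennreal (cauchy_weight (x::'a)) \<partial>lborel)
      = (\<integral>\<^sup>+x. (\<Prod>b\<in>Basis. ennreal (1 / (1 + ((x::'a) \<bullet> b)\<^sup>2))) \<partial>lborel)"
    unfolding cauchy_weight_def by (intro nn_integral_cong) (subst prod_ennreal, auto)
  also have "\<dots> = (\<Prod>b\<in>(Basis::'a set). (\<integral>\<^sup>+x. ennreal (1 / (1 + x\<^sup>2)) \<partial>lborel))"
    by (rule nn_integral_lborel_prod) auto
  also have "\<dots> < \<infinity>"
    using nn_integral_inverse_1_plus_square_finite
    by (simp add: power_less_top_ennreal)
  finally show ?thesis .
qed

lemma integrable_cauchy_weight: "integrable lborel cauchy_weight"
  using nn_integral_cauchy_weight_finite
  by (intro integrableI_bounded) (auto simp: cauchy_weight_nonneg)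

lemma norm_square_Basis: "(norm x)\<^sup>2 = (\<Sum>b\<in>Basis. (x \<bullet> b)\<^sup>2)"
  unfolding power2_norm_eq_inner by (subst euclidean_inner) (simp add: power2_eq_square)

lemma exp_neg_norm_square_le: "exp (- (norm x)\<^sup>2) \<le> cauchy_weight x"
proof -
  have "exp (- (norm x)\<^sup>2) = (\<Prod>b\<in>Basis. exp (- (x \<bullet> b)\<^sup>2))"
    by (simp add: norm_square_Basis exp_sum sum_negf[symmetric])
  also have "\<dots> \<le> cauchy_weight x"
    unfolding cauchy_weight_def
  proof (rule prod_mono)
    fix b
    have "1 + (x \<bullet> b)\<^sup>2 \<le> exp ((x \<bullet> b)\<^sup>2)" by (rule exp_ge_add_one_self)
    then show "0 \<le> exp (- (x \<bullet> b)\<^sup>2) \<and> exp (- (x \<bullet> b)\<^sup>2) \<le> 1 / (1 + (x \<bullet> b)\<^sup>2)"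
      by (simp add: exp_minus divide_inverse add_pos_nonneg)
  qed
  finally show ?thesis .
qed

lemma inverse_norm_pow_le: "(1 / (1 + (norm x)\<^sup>2)) ^ DIM('a) \<le> cauchy_weight (x::'a::euclidean_space)"
proof -
  have "(1 / (1 + (norm x)\<^sup>2)) ^ DIM('a) = (\<Prod>b\<in>(Basis::'a set). 1 / (1 + (norm x)\<^sup>2))" by simp
  also have "\<dots> \<le> cauchy_weight x"
    unfolding cauchy_weight_def
  proof (rule prod_mono)
    fix b :: 'a assume "b \<in> Basis"
    then have "(x \<bullet> b)\<^sup>2 \<le> (norm x)\<^sup>2"
      using Basis_le_norm[of b x] by (simp add: abs_le_square_iff[symmetric])
    then show "0 \<le> 1 / (1 + (norm x)\<^sup>2) \<and> 1 / (1 + (norm x)\<^sup>2) \<le> 1 / (1 + (x \<bullet> b)\<^sup>2)"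
      by (auto intro!: divide_left_mono mult_pos_pos add_pos_nonneg)
  qed
  finally show ?thesis .
qed

text \<open>Finiteness allows a real number above the sphere volume to be chosen as
  \<open>Vm\<close>. The induced metric is conformal, so its density is
  \<open>(2 / (1 + (norm x)\<^sup>2)) ^ CARD('n)\<close>, a constant times a function below
  \<open>cauchy_weight\<close>.\<close>

lemma sphere_volume_finite: "sphere_volume TYPE('n::finite) < \<infinity>"
proof -
  have "sqrt (det (induced_metric inv_stereographic x)) \<le> 2 ^ CARD('n) * cauchy_weight x" for x :: "real^'n"
  proof -
    have "det (induced_metric inv_stereographic x) = ((2 / (1 + (norm x)\<^sup>2))\<^sup>2) ^ CARD('n)"
      unfolding induced_metric_inv_stereographic by (subst det_diagonal) (auto simp: mat_def)
    also have "\<dots> = ((2 / (1 + (norm x)\<^sup>2)) ^ CARD('n))\<^sup>2"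
      by (simp flip: power_mult add: mult.commute)
    finally have "sqrt (det (induced_metric inv_stereographic x)) = (2 / (1 + (norm x)\<^sup>2)) ^ CARD('n)"
      by (simp del: power_divide)
    then have "sqrt (det (induced_metric inv_stereographic x)) = 2 ^ CARD('n) * (1 / (1 + (norm x)\<^sup>2)) ^ CARD('n)"
      by (simp add: power_divide)
    then show ?thesis
      using inverse_norm_pow_le[of x] by (simp del: power_divide)
  qed
  then have "sphere_volume TYPE('n) \<le> (\<integral>\<^sup>+x. ennreal (2 ^ CARD('n) * cauchy_weight (x::real^'n)) \<partial>lborel)"
    unfolding sphere_volume_def parametrised_volume_def by (intro nn_integral_mono ennreal_leI)
  also have "\<dots> = ennreal (2 ^ CARD('n)) * (\<integral>\<^sup>+x. ennreal (cauchy_weight (x::real^'n)) \<partial>lborel)"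
    by (subst nn_integral_cmult[symmetric]) (auto simp: ennreal_mult cauchy_weight_nonneg)
  also have "\<dots> < \<infinity>"
    using nn_integral_cauchy_weight_finite[where 'a = "real^'n"] by (auto simp: ennreal_mult_less_top)
  finally show ?thesis .
qed

section \<open>Polar coordinates in the variable |x|^2\<close>

text \<open>Both measures give \<open>{..a}\<close> the volume \<open>\<omega> * a ^ m\<close> of
  the ball of radius \<open>sqrt a\<close> when \<open>a \<ge> 0\<close>, and zero otherwise; such
  half-lines generate the Borel sets and are stable under intersection.\<close>

lemma distr_norm_square:
  assumes "DIM('a::euclidean_space) = 2 * m" "m \<ge> 1"
  defines "\<omega> \<equiv> unit_ball_vol (2 * real m)"
  shows "distr lborel borel (\<lambda>x::'a. (norm x)\<^sup>2)
    = density lborel (\<lambda>\<tau>. ennreal (real m * \<omega> * \<tau> ^ (m - 1)) * indicator {0..} \<tau>)" (is "?M = ?N")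
proof (rule measure_eqI_generator_eq[where E = "range (\<lambda>a::real. {..a})" and \<Omega> = UNIV and A = "\<lambda>i. {..real i}"])
  show "Int_stable (range (\<lambda>a::real. {..a}))"
    by (auto simp: Int_stable_def)
  show "sets ?M = sigma_sets UNIV (range (\<lambda>a::real. {..a}))" "sets ?N = sigma_sets UNIV (range (\<lambda>a::real. {..a}))"
    by (simp_all add: borel_eq_atMost)
  have \<omega>: "\<omega> \<ge> 0" by (simp add: \<omega>_def)
  have 1: "emeasure ?M {..a} = ennreal (if a \<ge> 0 then \<omega> * a ^ m else 0)" for a
  proof -
    have "emeasure ?M {..a} = emeasure lborel ((\<lambda>x::'a. (norm x)\<^sup>2) -` {..a})"
      by (subst emeasure_distr) auto
    also have "(\<lambda>x::'a. (norm x)\<^sup>2) -` {..a} = (if a \<ge> 0 then cball 0 (sqrt a) else {})"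
    proof (cases "a \<ge> 0")
      case True
      then have "(norm x)\<^sup>2 \<le> a \<longleftrightarrow> norm x \<le> sqrt a" for x :: 'a
        using real_sqrt_le_iff[of "(norm x)\<^sup>2" a] by simp
      with True show ?thesis by auto
    qed (auto intro: order_trans[OF zero_le_power2])
    also have "emeasure lborel \<dots> = ennreal (if a \<ge> 0 then \<omega> * a ^ m else 0)"
      by (auto simp: emeasure_cball assms(1) \<omega>_def power_mult)
    finally show ?thesis .
  qed
  show "emeasure ?M X = emeasure ?N X" if "X \<in> range (\<lambda>a. {..a})" for X
  proof -
    from that obtain a where X: "X = {..a}" by auto
    have "emeasure ?N X = (\<integral>\<^sup>+\<tau>. ennreal (real m * \<omega> * \<tau> ^ (m - 1)) * indicator {0..a} \<tau> \<partial>lborel)"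
      unfolding X by (subst emeasure_density) (auto intro!: nn_integral_cong simp: indicator_def)
    also have "\<dots> = ennreal (if a \<ge> 0 then \<omega> * a ^ m else 0)"
    proof (cases "a \<ge> 0")
      case True
      have "(\<integral>\<^sup>+\<tau>. ennreal (real m * \<omega> * \<tau> ^ (m - 1)) * indicator {0..a} \<tau> \<partial>lborel)
          = ennreal (\<omega> * a ^ m - \<omega> * 0 ^ m)"
        by (rule nn_integral_FTC_Icc) (use True \<omega> in \<open>auto intro!: derivative_eq_intros\<close>)
      then show ?thesis using True assms(2) by (simp add: zero_power)
    qed auto
    finally show ?thesis by (simp add: 1 X)
  qed
  show "emeasure ?M {..real i} \<noteq> \<infinity>" for i by (simp add: 1)
  show "(\<Union>i. {..real i}) = UNIV" by (auto intro: real_arch_simple)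
qed auto

lemma radial_integral_bound:
  assumes f: "continuous_on {0..} f" "\<And>s. 0 \<le> s \<Longrightarrow> 0 \<le> f s"
    and m: "DIM('a::euclidean_space) = 2 * m" "m \<ge> 1"
    and K: "(\<integral>\<^sup>+x. ennreal (f ((norm (x::'a))\<^sup>2)) \<partial>lborel) \<le> ennreal K" "0 \<le> K" and s: "0 \<le> s"
  shows "real m * unit_ball_vol (2 * real m) * integral {0..s} (\<lambda>\<tau>. \<tau> ^ (m - 1) * f \<tau>) \<le> K"
proof -
  define c where "c = real m * unit_ball_vol (2 * real m)"
  have c: "c \<ge> 0" by (simp add: c_def)
  \<comment> \<open>Continuity of \<open>f\<close> is assumed on the half-line only; freezing it at
    \<open>f 0\<close> for negative arguments gives a Borel function on the whole line.\<close>
  define F where "F \<tau> = ennreal (f (max 0 \<tau>))" for \<tau>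
  have F: "F \<in> borel_measurable borel"
  proof -
    have "continuous_on UNIV (\<lambda>\<tau>. f (max 0 \<tau>))"
      by (rule continuous_on_compose2[OF f(1)]) (auto intro!: continuous_intros)
    then have [measurable]: "(\<lambda>\<tau>. f (max 0 \<tau>)) \<in> borel_measurable borel"
      by (rule borel_measurable_continuous_onI)
    show ?thesis unfolding F_def by measurable
  qed
  have int: "(\<lambda>\<tau>. c * \<tau> ^ (m - 1) * f \<tau>) integrable_on {0..s}"
    by (intro integrable_continuous_real continuous_intros continuous_on_subset[OF f(1)]) auto
  have "ennreal (integral {0..s} (\<lambda>\<tau>. c * \<tau> ^ (m - 1) * f \<tau>))
      = (\<integral>\<^sup>+\<tau>. ennreal (c * \<tau> ^ (m - 1) * f \<tau>) * indicator {0..s} \<tau> \<partial>lborel)"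
    using f(2) c by (intro nn_integral_has_integral_lebesgue'[symmetric] integrable_integral int) auto
  also have "\<dots> \<le> (\<integral>\<^sup>+\<tau>. (ennreal (c * \<tau> ^ (m - 1)) * indicator {0..} \<tau>) * F \<tau> \<partial>lborel)"
    using f(2) c
    by (intro nn_integral_mono) (auto simp: indicator_def F_def ennreal_mult'' max_def)
  also have "\<dots> = (\<integral>\<^sup>+\<tau>. F \<tau> \<partial>density lborel (\<lambda>\<tau>. ennreal (c * \<tau> ^ (m - 1)) * indicator {0..} \<tau>))"
    using F by (subst nn_integral_density) auto
  also have "\<dots> = (\<integral>\<^sup>+\<tau>. F \<tau> \<partial>distr lborel borel (\<lambda>x::'a. (norm x)\<^sup>2))"
    unfolding distr_norm_square[OF m] c_def ..
  also have "\<dots> = (\<integral>\<^sup>+x. ennreal (f ((norm (x::'a))\<^sup>2)) \<partial>lborel)"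
    using F by (subst nn_integral_distr) (auto simp: F_def)
  also note K(1)
  finally have "integral {0..s} (\<lambda>\<tau>. c * \<tau> ^ (m - 1) * f \<tau>) \<le> K" using K(2) by simp
  then show ?thesis by (simp add: c_def mult.assoc)
qed

section \<open>Solving the radial equation\<close>

definition source :: "nat \<Rightarrow> real \<Rightarrow> real \<Rightarrow> real" where
  "source m t s = fact (2 * m - 1) * exp (2 * real m * (t * s - \<bar>t\<bar>))"

text \<open>With B = 4 m (2m - 1)! and beta = 2 m (|t| + 1), this is exp (B exp (beta s)). Its
  derivative is B beta exp (beta s) times itself, so integrating the weight against the growth rate
  of the source returns the weight with a small factor.\<close>

definition weight :: "nat \<Rightarrow> real \<Rightarrow> real \<Rightarrow> real" where
  "weight m t s = exp (4 * real m * fact (2 * m - 1) * exp (2 * real m * (\<bar>t\<bar> + 1) * s))"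

lemma continuous_source [continuous_intros]:
  "continuous_on A f \<Longrightarrow> continuous_on A g \<Longrightarrow> continuous_on A (\<lambda>x. source m (f x) (g x))"
  unfolding source_def by (intro continuous_intros)

lemma continuous_weight [continuous_intros]:
  "continuous_on A f \<Longrightarrow> continuous_on A g \<Longrightarrow> continuous_on A (\<lambda>x. weight m (f x) (g x))"
  unfolding weight_def by (intro continuous_intros)

lemma weight_ge_1: "1 \<le> weight m t s"
  unfolding weight_def by simp

lemma weight_pos [simp]: "0 < weight m t s"
  unfolding weight_def by simp

lemma source_pos [simp]: "0 < source m t s"
  unfolding source_def by simp

text \<open>The \<open>+ 1\<close> keeps the growth rate at least 1 even for \<open>t = 0\<close>,
  which the weighted estimate needs when it discards the division by this rate.\<close>

lemma source_le: "0 \<le> s \<Longrightarrow> source m t s \<le> fact (2 * m - 1) * exp (2 * real m * (\<bar>t\<bar> + 1) * s)"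
proof -
  assume s: "0 \<le> s"
  have "t * s - \<bar>t\<bar> \<le> \<bar>t\<bar> * s"
    using mult_right_mono[OF abs_ge_self[of t] s] by linarith
  also have "\<dots> \<le> (\<bar>t\<bar> + 1) * s" using s by (simp add: algebra_simps)
  finally have "2 * real m * (t * s - \<bar>t\<bar>) \<le> 2 * real m * ((\<bar>t\<bar> + 1) * s)"
    by (rule mult_left_mono) simp
  then show ?thesis by (simp add: source_def mult.assoc)
qed

section \<open>Weighted estimates for the inverse Laplacian\<close>

lemma avg_le_of_mono:
  assumes "continuous_on {0..} g" "0 \<le> s" "0 \<le> g s"
    and "\<And>\<sigma>. 0 \<le> \<sigma> \<Longrightarrow> \<sigma> \<le> s \<Longrightarrow> g \<sigma> \<le> g s"
  shows "avg k g s \<le> g s"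
proof -
  have "avg k g s \<le> avg k (\<lambda>_. g s) s"
    using assms by (intro avg_mono) auto
  also have "\<dots> \<le> g s" using assms(3) by (simp add: avg_const divide_le_eq mult_le_cancel_left1 mult_nonneg_nonneg distrib_left)
  finally show ?thesis .
qed

text \<open>The weight grows fast enough to absorb the exponential growth of the Lipschitz constant
  of the nonlinearity, so one contraction covers the whole half-line and all parameters.\<close>

lemma inv_lap_weight_le:
  fixes t :: real
  assumes "m \<ge> 1" "0 \<le> s"
  defines "g \<equiv> \<lambda>\<sigma>. exp (2 * real m * (\<bar>t\<bar> + 1) * \<sigma>) * weight m t \<sigma>"
  shows "inv_lap m g s \<le> weight m t s / (4 * real m * fact (2 * m - 1))"
proof -
  define B :: real where "B = 4 * real m * fact (2 * m - 1)"
  define \<beta> where "\<beta> = 2 * real m * (\<bar>t\<bar> + 1)"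
  have B: "B > 0" using assms(1) by (simp add: B_def)
  have \<beta>: "\<beta> \<ge> 1"
    using assms(1) mult_mono[of 1 "real m" 1 "\<bar>t\<bar> + 1"] by (simp add: \<beta>_def)
  have g: "g = (\<lambda>\<sigma>. exp (\<beta> * \<sigma>) * exp (B * exp (\<beta> * \<sigma>)))"
    by (simp add: g_def weight_def B_def \<beta>_def)
  have cg: "continuous_on {0..} g"
    unfolding g by (intro continuous_intros)
  \<comment> \<open>The integrand is increasing, so the inner average is at most the value at its
    right endpoint; a single explicit integration remains.\<close>
  have "avg 0 (avg (m - 1) g) s \<le> avg 0 g s"
  proof (intro avg_mono continuous_on_avg cg assms(2) avg_le_of_mono)
    fix \<sigma> \<tau> :: real assume "0 \<le> \<tau>" "\<tau> \<le> \<sigma>"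
    then have "exp (\<beta> * \<tau>) \<le> exp (\<beta> * \<sigma>)" using \<beta> by simp
    moreover from this have "exp (B * exp (\<beta> * \<tau>)) \<le> exp (B * exp (\<beta> * \<sigma>))" using B by simp
    ultimately show "g \<tau> \<le> g \<sigma>" unfolding g by (rule mult_mono) auto
  qed (auto simp: g)
  then have "inv_lap m g s \<le> s / 4 * avg 0 g s"
    unfolding inv_lap_def using assms(2) by (intro mult_left_mono) auto
  also have "\<dots> = integral {0..s} g / 4"
    using mult_avg_0_eq_integral[OF cg assms(2)] by simp
  also have "(g has_integral (exp (B * exp (\<beta> * s)) / (B * \<beta>) - exp (B * exp (\<beta> * 0)) / (B * \<beta>))) {0..s}"
    using B \<beta> unfolding g
    by (intro fundamental_theorem_of_calculus assms)
      (auto intro!: derivative_eq_intros simp: has_real_derivative_iff_has_vector_derivative[symmetric])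
  then have "integral {0..s} g = (exp (B * exp (\<beta> * s)) / (B * \<beta>) - exp (B * exp (\<beta> * 0)) / (B * \<beta>))"
    by (rule integral_unique)
  also have "\<dots> / 4 \<le> exp (B * exp (\<beta> * s)) / (B * \<beta>)"
    using B \<beta> by (simp add: field_simps add_increasing)
  also have "\<dots> \<le> exp (B * exp (\<beta> * s)) / B"
    using B \<beta> by (intro divide_left_mono) auto
  also have "\<dots> = weight m t s / B" by (simp add: weight_def B_def \<beta>_def)
  finally show ?thesis by (simp add: B_def)
qed

text \<open>One application already yields the bound. The result lies below the original integrand,
  since the divisor and the exponential factor are at least 1; by monotonicity every further
  application reproduces the same bound.\<close>

lemma inv_lap_pow_weight_le:
  assumes "m \<ge> 1" "0 \<le> s"
  shows "(inv_lap m ^^ Suc k) (\<lambda>\<sigma>. exp (2 * real m * (\<bar>t\<bar> + 1) * \<sigma>) * weight m t \<sigma>) s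
    \<le> weight m t s / (4 * real m * fact (2 * m - 1))"
  using assms(2)
proof (induction k arbitrary: s)
  case 0
  then show ?case using inv_lap_weight_le[OF assms(1)] by simp
next
  case (Suc k)
  let ?g = "\<lambda>\<sigma>. exp (2 * real m * (\<bar>t\<bar> + 1) * \<sigma>) * weight m t \<sigma>"
  have c: "continuous_on {0..} ?g" by (intro continuous_intros)
  have "(inv_lap m ^^ Suc k) ?g \<sigma> \<le> ?g \<sigma>" if "0 \<le> \<sigma>" for \<sigma>
  proof -
    have "1 * 1 \<le> (4 * real m) * (fact (2 * m - 1) :: real)"
      using assms(1) by (intro mult_mono) auto
    then have "weight m t \<sigma> / (4 * real m * fact (2 * m - 1)) \<le> weight m t \<sigma>"
      using weight_ge_1[of m t \<sigma>] by (simp add: divide_le_eq mult_le_cancel_left1)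
    also have "\<dots> \<le> ?g \<sigma>" using that by simp
    finally show ?thesis using Suc.IH[OF that] by linarith
  qed
  then have "inv_lap m ((inv_lap m ^^ Suc k) ?g) s \<le> inv_lap m ?g s"
    by (intro inv_lap_mono continuous_on_inv_lap_pow c Suc.prems)
  then show ?case using inv_lap_weight_le[OF assms(1) Suc.prems, of t] by simp
qed

section \<open>The contraction and its fixed point\<close>

text \<open>The absolute values turn the exponential into a bounded, globally Lipschitz function, as
  a global contraction argument requires. The estimate follows from 1 + y \<le> exp y.\<close>

lemma exp_neg_abs_lipschitz:
  fixes a b c :: real
  assumes "0 \<le> c"
  shows "\<bar>exp (- c * \<bar>a\<bar>) - exp (- c * \<bar>b\<bar>)\<bar> \<le> c * \<bar>a - b\<bar>"
proof -
  have le: "exp (- c * \<bar>a\<bar>) - exp (- c * \<bar>b\<bar>) \<le> c * \<bar>a - b\<bar>" for a b :: real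
  proof -
    have "exp (- c * \<bar>a\<bar>) - exp (- c * \<bar>b\<bar>) = exp (- c * \<bar>a\<bar>) * (1 - exp (c * (\<bar>a\<bar> - \<bar>b\<bar>)))"
      by (simp add: algebra_simps exp_add[symmetric])
    also have "\<dots> \<le> exp (- c * \<bar>a\<bar>) * (c * \<bar>a - b\<bar>)"
    proof (rule mult_left_mono)
      have "1 - exp (c * (\<bar>a\<bar> - \<bar>b\<bar>)) \<le> c * (\<bar>b\<bar> - \<bar>a\<bar>)"
        using exp_ge_add_one_self[of "c * (\<bar>a\<bar> - \<bar>b\<bar>)"] by (simp add: algebra_simps)
      also have "\<dots> \<le> c * \<bar>a - b\<bar>" using assms by (intro mult_left_mono) auto
      finally show "1 - exp (c * (\<bar>a\<bar> - \<bar>b\<bar>)) \<le> c * \<bar>a - b\<bar>" .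
    qed auto
    also have "\<dots> \<le> 1 * (c * \<bar>a - b\<bar>)"
      using assms by (intro mult_right_mono) auto
    finally show ?thesis by simp
  qed
  show ?thesis using le[of a b] le[of b a] by (simp add: abs_le_iff abs_minus_commute)
qed

text \<open>The unknown is \<open>g\<close>, the potential divided by the weight, so the sup norm of
  \<open>g\<close> is a weighted norm of the potential. The absolute value is a truncation that
  disappears at the nonnegative fixed point.\<close>

definition picard :: "nat \<Rightarrow> (real \<times> real \<Rightarrow> real) \<Rightarrow> real \<Rightarrow> real \<Rightarrow> real" where
  "picard m g t s = (inv_lap m ^^ m) (\<lambda>\<sigma>. source m t \<sigma> * exp (- (2 * real m) * \<bar>weight m t \<sigma> * g (t, \<sigma>)\<bar>)) s"

context
  fixes m :: nat
  assumes m: "m \<ge> 1"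
begin

lemma picard_integrand_continuous:
  assumes "continuous_on UNIV g"
  shows "continuous_on {0..} (\<lambda>\<sigma>. source m t \<sigma> * exp (- (2 * real m) * \<bar>weight m t \<sigma> * g (t, \<sigma>)\<bar>))"
  by (intro continuous_intros continuous_on_compose2[OF assms]) auto

text \<open>Reflection by \<open>\<bar>snd p\<bar>\<close> extends the iterate to the whole plane,
  where the space of bounded continuous functions lives.\<close>

lemma picard_continuous:
  assumes "continuous_on UNIV g"
  shows "continuous_on UNIV (\<lambda>p. picard m g (fst p) \<bar>snd p\<bar> / weight m (fst p) \<bar>snd p\<bar>)"
proof -
  have "continuous_on (UNIV \<times> {0..}) (\<lambda>(t, s). picard m g t s)"
    unfolding picard_def
    by (intro continuous_on_inv_lap_pow_param)
      (auto intro!: continuous_intros continuous_on_compose2[OF assms] simp: case_prod_beta)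
  from continuous_on_compose2[OF this, of UNIV "\<lambda>p. (fst p, \<bar>snd p\<bar>)"]
  have "continuous_on UNIV (\<lambda>p. picard m g (fst p) \<bar>snd p\<bar>)"
    by (auto simp: continuous_on_Pair continuous_on_fst continuous_on_snd continuous_on_rabs image_subset_iff)
  then show ?thesis by (intro continuous_intros) (auto simp: weight_def)
qed

text \<open>The Lipschitz constant \<open>2 * m\<close> of the exponential times the factor
  \<open>fact (2 * m - 1)\<close> of the source meets the gain
  \<open>1 / (4 * m * fact (2 * m - 1))\<close> from the weight, leaving the contraction factor
  1/2.\<close>

lemma picard_lipschitz:
  assumes "continuous_on UNIV g" "continuous_on UNIV g'" "\<And>p. \<bar>g p - g' p\<bar> \<le> d" "0 \<le> s"
  shows "picard m g t s - picard m g' t s \<le> d / 2 * weight m t s"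
proof -
  let ?F = "\<lambda>g \<sigma>. source m t \<sigma> * exp (- (2 * real m) * \<bar>weight m t \<sigma> * g (t, \<sigma>)\<bar>)"
  let ?w = "\<lambda>\<sigma>. exp (2 * real m * (\<bar>t\<bar> + 1) * \<sigma>) * weight m t \<sigma>"
  let ?c = "2 * real m * fact (2 * m - 1) * d"
  have d: "d \<ge> 0" using assms(3)[of undefined] by linarith
  have cw: "continuous_on {0..} (\<lambda>\<sigma>. ?c * ?w \<sigma>)"
    by (intro continuous_intros)
  note cF = picard_integrand_continuous[OF assms(1)] picard_integrand_continuous[OF assms(2)]
  have "?F g \<sigma> \<le> ?F g' \<sigma> + ?c * ?w \<sigma>" if "0 \<le> \<sigma>" for \<sigma>
  proof -
    have "exp (- (2 * real m) * \<bar>weight m t \<sigma> * g (t, \<sigma>)\<bar>) - exp (- (2 * real m) * \<bar>weight m t \<sigma> * g' (t, \<sigma>)\<bar>)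
        \<le> 2 * real m * \<bar>weight m t \<sigma> * g (t, \<sigma>) - weight m t \<sigma> * g' (t, \<sigma>)\<bar>"
      using exp_neg_abs_lipschitz[of "2 * real m" "weight m t \<sigma> * g (t, \<sigma>)" "weight m t \<sigma> * g' (t, \<sigma>)"]
      by linarith
    also have "\<dots> = 2 * real m * (weight m t \<sigma> * \<bar>g (t, \<sigma>) - g' (t, \<sigma>)\<bar>)"
      by (simp add: abs_mult right_diff_distrib[symmetric] abs_of_pos)
    also have "\<dots> \<le> 2 * real m * (weight m t \<sigma> * d)"
      using assms(3) by (intro mult_left_mono) (auto simp: less_imp_le)
    finally have "?F g \<sigma> - ?F g' \<sigma> \<le> source m t \<sigma> * (2 * real m * (weight m t \<sigma> * d))"
      unfolding right_diff_distrib[symmetric] by (rule mult_left_mono) (simp add: less_imp_le)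
    also have "\<dots> \<le> (fact (2 * m - 1) * exp (2 * real m * (\<bar>t\<bar> + 1) * \<sigma>)) * (2 * real m * (weight m t \<sigma> * d))"
      using d by (intro mult_right_mono source_le that) (auto simp: less_imp_le)
    finally show ?thesis by (simp add: algebra_simps)
  qed
  then have "(inv_lap m ^^ m) (?F g) s \<le> (inv_lap m ^^ m) (\<lambda>\<sigma>. ?F g' \<sigma> + ?c * ?w \<sigma>) s"
    by (intro inv_lap_pow_mono cF continuous_on_add cw assms)
  also have "\<dots> = (inv_lap m ^^ m) (?F g') s + (inv_lap m ^^ m) (\<lambda>\<sigma>. ?c * ?w \<sigma>) s"
    by (intro inv_lap_pow_add cF cw assms)
  also have "(inv_lap m ^^ m) (\<lambda>\<sigma>. ?c * ?w \<sigma>) s = ?c * (inv_lap m ^^ Suc (m - 1)) ?w s"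
    using m by (simp add: inv_lap_pow_cmult)
  also have "\<dots> \<le> ?c * (weight m t s / (4 * real m * fact (2 * m - 1)))"
    using d by (intro mult_left_mono inv_lap_pow_weight_le m assms) auto
  also have "\<dots> = d / 2 * weight m t s" using m by simp
  finally show ?thesis unfolding picard_def by simp
qed

lemma picard_bounded:
  assumes "continuous_on UNIV g" "0 \<le> s"
  shows "0 \<le> picard m g t s" "picard m g t s \<le> weight m t s"
proof -
  let ?F = "\<lambda>\<sigma>. source m t \<sigma> * exp (- (2 * real m) * \<bar>weight m t \<sigma> * g (t, \<sigma>)\<bar>)"
  let ?w = "\<lambda>\<sigma>. exp (2 * real m * (\<bar>t\<bar> + 1) * \<sigma>) * weight m t \<sigma>"
  let ?c = "fact (2 * m - 1) :: real"
  note cF = picard_integrand_continuous[OF assms(1)]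
  show "0 \<le> picard m g t s"
    unfolding picard_def by (intro inv_lap_pow_nonneg cF assms) (auto simp: less_imp_le)
  have "?F \<sigma> \<le> ?c * ?w \<sigma>" if "0 \<le> \<sigma>" for \<sigma>
  proof -
    have "?F \<sigma> \<le> source m t \<sigma> * 1"
      by (intro mult_left_mono) (auto simp: less_imp_le)
    also have "\<dots> \<le> (?c * exp (2 * real m * (\<bar>t\<bar> + 1) * \<sigma>)) * weight m t \<sigma>"
      by (intro mult_mono source_le that weight_ge_1) (auto simp: less_imp_le)
    finally show ?thesis by (simp add: mult.assoc)
  qed
  then have "picard m g t s \<le> (inv_lap m ^^ m) (\<lambda>\<sigma>. ?c * ?w \<sigma>) s"
    unfolding picard_def by (intro inv_lap_pow_mono cF assms continuous_intros)
  also have "\<dots> = ?c * (inv_lap m ^^ Suc (m - 1)) ?w s"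
    using m by (simp add: inv_lap_pow_cmult)
  also have "\<dots> \<le> ?c * (weight m t s / (4 * real m * ?c))"
    by (intro mult_left_mono inv_lap_pow_weight_le m assms) auto
  also have "\<dots> = weight m t s / (4 * real m)" using m by simp
  also have "\<dots> \<le> weight m t s" using m weight_pos[of m t s] by (simp add: divide_le_eq mult_le_cancel_left1 not_less less_imp_le del: weight_pos)
  finally show "picard m g t s \<le> weight m t s" .
qed

text \<open>Banach's fixed point theorem on bounded continuous functions of the pair
  \<open>(t, s)\<close>. Treating \<open>t\<close> as a coordinate, instead of solving for each
  \<open>t\<close> separately, yields joint continuity of the solution directly.\<close>

lemma exists_potential:
  "\<exists>h. continuous_on (UNIV \<times> {0..}) (\<lambda>(t, s). h t s) \<and>
    (\<forall>t s. 0 \<le> s \<longrightarrow> 0 \<le> h t s \<and>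
      h t s = (inv_lap m ^^ m) (\<lambda>\<sigma>. source m t \<sigma> * exp (- (2 * real m) * h t \<sigma>)) s)"
proof -
  define \<Phi> where "\<Phi> g p = picard m g (fst p) \<bar>snd p\<bar> / weight m (fst p) \<bar>snd p\<bar>" for g p
  have \<Phi>: "\<Phi> (apply_bcontfun g) \<in> bcontfun" for g
    unfolding \<Phi>_def
    by (rule bcontfun_normI[where b = 1])
      (use picard_bounded[of "apply_bcontfun g"] in
        \<open>auto intro!: picard_continuous simp: less_imp_le divide_le_eq\<close>)
  have ap: "apply_bcontfun (Bcontfun (\<Phi> (apply_bcontfun g))) = \<Phi> (apply_bcontfun g)" for g
    by (rule Bcontfun_inverse[OF \<Phi>])
  have "\<exists>!g. Bcontfun (\<Phi> (apply_bcontfun g)) = g"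
  proof (rule banach_fix_type[of "1/2"])
    show "\<forall>g g'. dist (Bcontfun (\<Phi> (apply_bcontfun g))) (Bcontfun (\<Phi> (apply_bcontfun g'))) \<le> 1 / 2 * dist g g'"
    proof (intro allI dist_bound)
      fix g g' :: "(real \<times> real) \<Rightarrow>\<^sub>C real" and p :: "real \<times> real"
      have le: "\<Phi> (apply_bcontfun g) p - \<Phi> (apply_bcontfun g') p \<le> 1 / 2 * dist g g'" for g g'
      proof -
        have "picard m (apply_bcontfun g) (fst p) \<bar>snd p\<bar> - picard m (apply_bcontfun g') (fst p) \<bar>snd p\<bar>
            \<le> dist g g' / 2 * weight m (fst p) \<bar>snd p\<bar>"
          using dist_bounded[of g _ g'] by (intro picard_lipschitz) (auto simp: dist_real_def)
        then show ?thesis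
          by (simp add: \<Phi>_def diff_divide_distrib[symmetric] divide_le_eq)
      qed
      show "dist (apply_bcontfun (Bcontfun (\<Phi> (apply_bcontfun g))) p)
          (apply_bcontfun (Bcontfun (\<Phi> (apply_bcontfun g'))) p) \<le> 1 / 2 * dist g g'"
        using le[of g g'] le[of g' g] unfolding ap dist_real_def dist_commute[of g' g] by linarith
    qed
  qed auto
  then obtain G where "Bcontfun (\<Phi> (apply_bcontfun G)) = G" by blast
  then have G: "apply_bcontfun G = \<Phi> (apply_bcontfun G)" using ap by metis
  define h where "h t s = weight m t s * apply_bcontfun G (t, s)" for t s
  have eq: "h t s = picard m (apply_bcontfun G) t s" if "0 \<le> s" for t s
    unfolding h_def using that by (subst G) (simp add: \<Phi>_def weight_def)
  have nonneg: "0 \<le> h t s" if "0 \<le> s" for t s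
    unfolding eq[OF that] using that by (intro picard_bounded) auto
  have "continuous_on (UNIV \<times> {0..}) (\<lambda>(t, s). h t s)"
    unfolding h_def case_prod_beta by (intro continuous_intros) auto
  moreover have "h t s = (inv_lap m ^^ m) (\<lambda>\<sigma>. source m t \<sigma> * exp (- (2 * real m) * h t \<sigma>)) s"
    if "0 \<le> s" for t s
    unfolding eq[OF that] picard_def
  proof (rule inv_lap_pow_cong[OF that])
    \<comment> \<open>Nonnegativity of the fixed point removes the truncation.\<close>
    fix \<sigma> :: real assume "0 \<le> \<sigma>"
    then show "source m t \<sigma> * exp (- (2 * real m) * \<bar>weight m t \<sigma> * apply_bcontfun G (t, \<sigma>)\<bar>)
        = source m t \<sigma> * exp (- (2 * real m) * h t \<sigma>)"
      using nonneg[of \<sigma> t] unfolding h_def by simp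
  qed
  ultimately show ?thesis using nonneg by blast
qed

end

section \<open>Volume as a function of the parameter\<close>

lemma inv_lap_mono_arg:
  assumes "continuous_on {0..} g" "\<And>s. 0 \<le> s \<Longrightarrow> 0 \<le> g s" "0 \<le> a" "a \<le> b"
  shows "inv_lap m g a \<le> inv_lap m g b"
proof -
  have c: "continuous_on {0..} (avg (m - 1) g)" by (intro continuous_on_avg assms)
  have nn: "0 \<le> avg (m - 1) g s" if "0 \<le> s" for s
    using avg_mono[of "\<lambda>_. 0" g s "m - 1"] assms that by simp
  have "integral {0..a} (avg (m - 1) g) \<le> integral {0..b} (avg (m - 1) g)"
    using assms nn by (intro integral_subset_le integrable_continuous_real continuous_on_subset[OF c]) auto
  then show ?thesis
    using mult_avg_0_eq_integral[OF c, of a] mult_avg_0_eq_integral[OF c, of b] assms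
    by (simp add: inv_lap_def)
qed

text \<open>Only \<open>\<theta>\<close> in \<open>{1/2..1}\<close> is kept: there
  \<open>\<theta> * s \<ge> s / 2 \<ge> b\<close>, so the lower bound on \<open>g\<close>
  applies.\<close>

lemma avg_ge_power:
  assumes g: "continuous_on {0..} g" "\<And>s. 0 \<le> s \<Longrightarrow> 0 \<le> g s"
    and "0 \<le> \<kappa>" "0 \<le> b" "\<And>s. b \<le> s \<Longrightarrow> \<kappa> * s ^ j \<le> g s" "2 * b \<le> s"
  shows "\<kappa> / 2 ^ (k + j + 1) * s ^ j \<le> avg k g s"
proof -
  have s: "0 \<le> s" using assms by linarith
  have "\<kappa> / 2 ^ (k + j + 1) * s ^ j = integral {1/2..1} (\<lambda>_::real. (1/2) ^ k * (\<kappa> * (s/2) ^ j))"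
    by (simp add: power_add power_divide)
  also have "\<dots> \<le> integral {1/2..1} (\<lambda>\<theta>. \<theta> ^ k * g (\<theta> * s))"
  proof (rule integral_le)
    show "(\<lambda>\<theta>. \<theta> ^ k * g (\<theta> * s)) integrable_on {1/2..1}"
      by (rule integrable_subinterval_real[OF avg_integrable[OF g(1) s]]) auto
    fix \<theta> :: real assume \<theta>: "\<theta> \<in> {1/2..1}"
    have *: "s / 2 \<le> \<theta> * s" using \<theta> s mult_right_mono[of "1/2" \<theta> s] by simp
    have "\<kappa> * (s/2) ^ j \<le> \<kappa> * (\<theta> * s) ^ j"
      using * s assms(3) by (intro mult_left_mono power_mono) auto
    also have "\<dots> \<le> g (\<theta> * s)" using * assms(6) by (intro assms(5)) linarith
    finally show "(1/2) ^ k * (\<kappa> * (s/2) ^ j) \<le> \<theta> ^ k * g (\<theta> * s)"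
      using \<theta> assms(3) s by (intro mult_mono power_mono) auto
  qed auto
  also have "\<dots> \<le> avg k g s"
    unfolding avg_def
    using g s by (intro integral_subset_le avg_integrable integrable_subinterval_real[OF avg_integrable[OF g(1) s]]) auto
  finally show ?thesis .
qed

text \<open>The first application turns the mass on \<open>{0..1}\<close> into a positive lower
  bound for \<open>s \<ge> 1\<close>; each further one gains a power of \<open>s\<close> from the
  factor \<open>s / 4\<close>, as averaging preserves powers up to constants. The constants are
  chosen before \<open>g\<close>, which later gives uniformity in \<open>t\<close>.\<close>

lemma inv_lap_pow_growth:
  assumes "m \<ge> 1" "\<kappa> > 0"
  shows "\<exists>\<kappa>'>0. \<exists>b\<ge>1. \<forall>g. continuous_on {0..} g \<longrightarrow> (\<forall>s\<ge>0. 0 \<le> g s) \<longrightarrow> (\<forall>s\<in>{0..1}. \<kappa> \<le> g s) \<longrightarrow>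
    (\<forall>s\<ge>b. \<kappa>' * s ^ j \<le> (inv_lap m ^^ Suc j) g s)"
proof (induction j)
  case 0
  have "\<kappa> / (4 * real m) * s ^ 0 \<le> (inv_lap m ^^ Suc 0) g s"
    if g: "continuous_on {0..} g" "\<forall>s\<ge>0. 0 \<le> g s" "\<forall>s\<in>{0..1}. \<kappa> \<le> g s" and "1 \<le> s" for g s
  proof -
    have "\<kappa> / (4 * real m) = inv_lap m (\<lambda>_. \<kappa>) 1" using assms(1) by (simp add: inv_lap_const)
    also have "\<dots> \<le> inv_lap m g 1" using g by (intro inv_lap_mono) auto
    also have "\<dots> \<le> inv_lap m g s" using g \<open>1 \<le> s\<close> by (intro inv_lap_mono_arg) auto
    finally show ?thesis by simp
  qed
  moreover have "\<kappa> / (4 * real m) > 0" using assms by simp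
  ultimately show ?case by (metis order_refl)
next
  case (Suc j)
  then obtain \<kappa>' b where *: "\<kappa>' > 0" "b \<ge> 1"
    "\<And>g s. continuous_on {0..} g \<Longrightarrow> (\<forall>s\<ge>0. 0 \<le> g s) \<Longrightarrow> (\<forall>s\<in>{0..1}. \<kappa> \<le> g s) \<Longrightarrow> s \<ge> b
      \<Longrightarrow> \<kappa>' * s ^ j \<le> (inv_lap m ^^ Suc j) g s"
    by blast
  \<comment> \<open>The two nested averages of \<open>inv_lap\<close> each cost a constant and
    double the threshold, hence \<open>4 * b\<close> below.\<close>
  define \<kappa>1 where "\<kappa>1 = \<kappa>' / 2 ^ (m - 1 + j + 1)"
  define \<kappa>2 where "\<kappa>2 = \<kappa>1 / 2 ^ (0 + j + 1)"
  have pos: "\<kappa>1 > 0" "\<kappa>2 > 0" using *(1) by (auto simp: \<kappa>1_def \<kappa>2_def)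
  have "\<kappa>2 / 4 * s ^ Suc j \<le> (inv_lap m ^^ Suc (Suc j)) g s"
    if g: "continuous_on {0..} g" "\<forall>s\<ge>0. 0 \<le> g s" "\<forall>s\<in>{0..1}. \<kappa> \<le> g s" and s: "4 * b \<le> s" for g s
  proof -
    define G where "G = (inv_lap m ^^ Suc j) g"
    have cG: "continuous_on {0..} G" unfolding G_def by (intro continuous_on_inv_lap_pow g)
    have G0: "0 \<le> G s" if "0 \<le> s" for s
      unfolding G_def using g that by (intro inv_lap_pow_nonneg) auto
    have G1: "0 \<le> avg (m - 1) G s" if "0 \<le> s" for s
      using avg_mono[of "\<lambda>_. 0" G s "m - 1"] cG G0 that by simp
    have 1: "\<kappa>1 * s ^ j \<le> avg (m - 1) G s" if "2 * b \<le> s" for s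
      unfolding \<kappa>1_def using * that *(3)[OF g] cG G0
      by (intro avg_ge_power[where b = b]) (auto simp: G_def simp del: funpow.simps)
    have "\<kappa>2 * s ^ j \<le> avg 0 (avg (m - 1) G) s"
      unfolding \<kappa>2_def using * pos s 1 cG G1
      by (intro avg_ge_power[where b = "2 * b"] continuous_on_avg) auto
    then have "s / 4 * (\<kappa>2 * s ^ j) \<le> inv_lap m G s"
      unfolding inv_lap_def using s *(2) by (intro mult_left_mono) auto
    then show ?thesis by (simp add: G_def mult_ac)
  qed
  moreover have "\<kappa>2 / 4 > 0" "4 * b \<ge> 1" using pos * by auto
  ultimately show ?case by (metis)
qed

text \<open>The inverse Laplacian of the constant \<open>M\<close> is
  \<open>M * s / (4 * m)\<close>, which is at most \<open>M\<close> as long as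
  \<open>s \<le> 4 * m\<close>.\<close>

lemma inv_lap_pow_le_const:
  assumes "m \<ge> 1" "continuous_on {0..} g" "0 \<le> M" "R \<le> 4 * real m"
    and "\<And>s. 0 \<le> s \<Longrightarrow> s \<le> R \<Longrightarrow> g s \<le> M" "0 \<le> s" "s \<le> R"
  shows "(inv_lap m ^^ k) g s \<le> M"
  using assms(6,7)
proof (induction k arbitrary: s)
  case (Suc k)
  have "(inv_lap m ^^ Suc k) g s \<le> inv_lap m (\<lambda>_. M) s"
    using Suc by (auto intro!: inv_lap_mono continuous_on_inv_lap_pow assms(2))
  also have "\<dots> = M * (s / (4 * real m))" using assms(1) by (simp add: inv_lap_const)
  also have "\<dots> \<le> M * 1"
    using Suc.prems assms(1,3,4) by (intro mult_left_mono) (auto simp: divide_le_eq)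
  finally show ?case by simp
qed (use assms(5) in simp)

section \<open>The one-parameter family of solutions\<close>

locale potential_family =
  fixes m :: nat and h :: "real \<Rightarrow> real \<Rightarrow> real"
  assumes m_odd: "odd m" and m_ge_3: "3 \<le> m"
    and h_continuous: "continuous_on (UNIV \<times> {0..}) (\<lambda>(t, s). h t s)"
    and h_nonneg: "0 \<le> s \<Longrightarrow> 0 \<le> h t s"
    and h_eq: "0 \<le> s \<Longrightarrow>
      h t s = (inv_lap m ^^ m) (\<lambda>\<sigma>. source m t \<sigma> * exp (- (2 * real m) * h t \<sigma>)) s"
begin

definition rhs where "rhs t s = source m t s * exp (- (2 * real m) * h t s)"

definition profile where "profile t s = t * s - \<bar>t\<bar> - h t s"

lemma rhs_eq: "rhs t s = fact (2 * m - 1) * exp (2 * real m * profile t s)"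
  by (simp add: rhs_def source_def profile_def exp_add[symmetric] algebra_simps)

lemma rhs_pos: "0 < rhs t s"
  by (simp add: rhs_eq)

lemma h_eq_rhs: "0 \<le> s \<Longrightarrow> h t s = (inv_lap m ^^ m) (rhs t) s"
  unfolding rhs_def[abs_def] by (rule h_eq)

lemma profile_continuous_param:
  assumes "continuous_on A f" "continuous_on A g" "\<And>x. x \<in> A \<Longrightarrow> 0 \<le> g x"
  shows "continuous_on A (\<lambda>x. profile (f x) (g x))"
proof -
  have "continuous_on A (\<lambda>x. (\<lambda>(t, s). h t s) (f x, g x))"
    by (rule continuous_on_compose2[OF h_continuous]) (use assms in \<open>auto intro!: continuous_intros\<close>)
  then show ?thesis unfolding profile_def by (auto intro!: continuous_intros assms)
qed

lemma Dk_rhs_of_h: "Dk k (h t) \<Longrightarrow> Dk k (rhs t)"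
proof -
  assume "Dk k (h t)"
  then have "Dk k (\<lambda>s. fact (2 * m - 1) * exp ((2 * real m) * ((t * s + (- \<bar>t\<bar>)) + (- 1) * h t s)))"
    by (intro Dk_mult Dk_exp Dk_add Dk_const Dk_id)
  then show ?thesis
    by (rule Dk_cong) (simp add: rhs_eq profile_def)
qed

text \<open>Bootstrapping: regularity of \<open>h\<close> passes to the right-hand side, and the
  outermost inverse Laplacian adds one order.\<close>

lemma Dk_h: "Dk k (h t)"
proof (induction k)
  case 0
  have "continuous_on {0..} (\<lambda>s. (\<lambda>(t, s). h t s) (t, s))"
    by (rule continuous_on_compose2[OF h_continuous]) (auto intro!: continuous_intros)
  then show ?case by simp
next
  case (Suc k)
  have "Dk (Suc k) (inv_lap m ((inv_lap m ^^ (m - 1)) (rhs t)))"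
    by (intro Dk_inv_lap Dk_inv_lap_pow Dk_rhs_of_h Suc)
  moreover have "inv_lap m ((inv_lap m ^^ (m - 1)) (rhs t)) s = h t s" if "0 \<le> s" for s
  proof -
    have "m = Suc (m - 1)" using m_ge_3 by simp
    then have "(inv_lap m ^^ m) (rhs t) s = (inv_lap m ^^ Suc (m - 1)) (rhs t) s" by simp
    then show ?thesis using h_eq_rhs[OF that] by simp
  qed
  ultimately show ?case by (rule Dk_cong)
qed

lemma Dk_rhs: "Dk k (rhs t)"
  by (intro Dk_rhs_of_h Dk_h)

lemma rhs_continuous: "continuous_on {0..} (rhs t)"
  by (intro Dk_imp_continuous_on Dk_rhs)

lemma Dk_profile: "Dk k (profile t)"
proof -
  have "Dk k (\<lambda>s. (t * s + (- \<bar>t\<bar>)) + (- 1) * h t s)"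
    by (intro Dk_mult Dk_add Dk_const Dk_id Dk_h)
  then show ?thesis by (rule Dk_cong) (simp add: profile_def)
qed

lemma smooth_profile: "smooth (\<lambda>x::real^'n. profile t ((norm x)\<^sup>2))"
  unfolding smooth_def by (intro allI Ck_radial Dk_profile)

text \<open>The terms \<open>- \<bar>t\<bar>\<close> and \<open>t * s\<close> are annihilated by the
  first two Laplacians, which are computed separately. They leave
  \<open>- (inv_lap m ^^ j) (rhs t)\<close> with \<open>j = m - 2\<close> odd, so the remaining sign
  \<open>(- 1) ^ j\<close> restores a positive right-hand side.\<close>

lemma neg_laplacian_pow_profile:
  assumes n: "CARD('n::finite) = 2 * m"
  shows "neg_laplacian_pow m (\<lambda>x::real^'n. profile t ((norm x)\<^sup>2))
    = (\<lambda>x. fact (2 * m - 1) * exp (2 * real m * profile t ((norm x)\<^sup>2)))"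
proof -
  define j where "j = m - 2"
  have mj: "m = Suc (Suc j)" "odd j" using m_ge_3 m_odd by (auto simp: j_def)
  define J where "J = (inv_lap m ^^ j) (rhs t)"
  \<comment> \<open>This is the Laplacian of the profile: the linear term \<open>t * s\<close> is
    the inverse Laplacian of the constant \<open>4 * m * t\<close>.\<close>
  define k1 where "k1 s = 4 * real m * t + (- 1) * inv_lap m J s" for s
  let ?L = "\<lambda>f (x::real^'n). - laplacian f x"
  have m1: "m \<ge> 1" using m_ge_3 by simp
  have DJ: "Dk k J" for k unfolding J_def by (intro Dk_inv_lap_pow Dk_rhs)
  have Dk1: "Dk k k1" for k unfolding k1_def[abs_def]
    by (intro Dk_add Dk_mult Dk_const Dk_Suc_imp[OF Dk_inv_lap] DJ)
  have p: "profile t s = - \<bar>t\<bar> + inv_lap m k1 s" if s: "0 \<le> s" for s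
  proof -
    have "inv_lap m k1 s = inv_lap m (\<lambda>_. 4 * real m * t) s + inv_lap m (\<lambda>s. (- 1) * inv_lap m J s) s"
      unfolding k1_def[abs_def]
      by (intro inv_lap_add s continuous_intros continuous_on_inv_lap Dk_imp_continuous_on[OF DJ])
    also have "\<dots> = t * s - inv_lap m (inv_lap m J) s"
      using m1 unfolding inv_lap_cmult by (simp add: inv_lap_const)
    also have "inv_lap m (inv_lap m J) s = h t s"
    proof -
      have "(inv_lap m ^^ m) (rhs t) = (inv_lap m ^^ Suc (Suc j)) (rhs t)"
        by (simp only: mj(1)[symmetric])
      then show ?thesis using h_eq_rhs[OF s, of t] by (simp add: J_def)
    qed
    finally show ?thesis by (simp add: profile_def)
  qed
  have 1: "?L (\<lambda>x. profile t ((norm x)\<^sup>2)) = (\<lambda>x. (- 4 * real m * t) + inv_lap m J ((norm x)\<^sup>2))"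
    using laplacian_inv_lap[OF Dk1 m1 n, of "- \<bar>t\<bar>"] by (simp add: p k1_def)
  have 2: "?L (\<lambda>x. (- 4 * real m * t) + inv_lap m J ((norm x)\<^sup>2))
      = (\<lambda>x. (inv_lap m ^^ j) (\<lambda>s. (- 1) * rhs t s) ((norm x)\<^sup>2))"
    using laplacian_inv_lap[OF DJ m1 n, of "- 4 * real m * t"]
    unfolding inv_lap_pow_cmult by (simp add: J_def)
  have "neg_laplacian_pow m (\<lambda>x::real^'n. profile t ((norm x)\<^sup>2))
      = neg_laplacian_pow (Suc (Suc j)) (\<lambda>x::real^'n. profile t ((norm x)\<^sup>2))"
    by (simp only: mj(1)[symmetric])
  also have "\<dots> = neg_laplacian_pow j (?L (?L (\<lambda>x. profile t ((norm x)\<^sup>2))))"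
    by (simp add: neg_laplacian_pow_def funpow_Suc_right del: funpow.simps)
  also have "\<dots> = (\<lambda>x. (- 1) ^ j * (- 1 * rhs t ((norm x)\<^sup>2)))"
    unfolding 1 2 by (intro neg_laplacian_pow_inv_lap m1 n Dk_mult Dk_const Dk_rhs)
  also have "\<dots> = (\<lambda>x. rhs t ((norm x)\<^sup>2))" using mj(2) by simp
  finally show ?thesis by (simp add: rhs_eq)
qed

text \<open>Here \<open>m \<ge> 3\<close> enters: \<open>h t s\<close> grows at least like \<open>s ^ (m - 1)\<close>, which beats the
  linear term \<open>t * s\<close>.\<close>

lemma profile_decay: "\<exists>C. \<forall>t s. \<bar>t\<bar> \<le> T \<longrightarrow> 0 \<le> s \<longrightarrow> 2 * real m * profile t s \<le> C - s"
proof -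
  define T' where "T' = max T 0"
  \<comment> \<open>On this compact set of parameters and radii the continuous positive function
    \<open>rhs\<close> has a positive minimum, giving a lower bound uniform in \<open>t\<close>.
    Using \<open>T'\<close> keeps the set nonempty when \<open>T\<close> is negative.\<close>
  let ?K = "{-T'..T'} \<times> {0..1::real}"
  have "continuous_on ?K (\<lambda>p. rhs (fst p) (snd p))"
    unfolding rhs_eq by (intro continuous_intros profile_continuous_param) auto
  moreover have "compact ?K" "?K \<noteq> {}" by (auto intro: compact_Times simp: T'_def)
  ultimately obtain p where p: "p \<in> ?K" "\<And>q. q \<in> ?K \<Longrightarrow> rhs (fst p) (snd p) \<le> rhs (fst q) (snd q)"
    using continuous_attains_inf[of ?K "\<lambda>p. rhs (fst p) (snd p)"] by blast
  define \<kappa> where "\<kappa> = rhs (fst p) (snd p)"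
  have \<kappa>: "\<kappa> > 0" "\<And>t s. \<bar>t\<bar> \<le> T \<Longrightarrow> 0 \<le> s \<Longrightarrow> s \<le> 1 \<Longrightarrow> \<kappa> \<le> rhs t s"
  proof -
    show "\<kappa> \<le> rhs t s" if "\<bar>t\<bar> \<le> T" "0 \<le> s" "s \<le> 1" for t s
      using p(2)[of "(t, s)"] that by (auto simp: \<kappa>_def T'_def abs_le_iff)
  qed (simp add: \<kappa>_def rhs_pos)
  obtain \<kappa>' b where b: "\<kappa>' > 0" "b \<ge> 1" "\<And>g s. continuous_on {0..} g \<Longrightarrow> (\<forall>s\<ge>0. 0 \<le> g s)
      \<Longrightarrow> (\<forall>s\<in>{0..1}. \<kappa> \<le> g s) \<Longrightarrow> s \<ge> b \<Longrightarrow> \<kappa>' * s ^ (m - 1) \<le> (inv_lap m ^^ Suc (m - 1)) g s"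
    using inv_lap_pow_growth[of m \<kappa> "m - 1"] \<kappa>(1) m_ge_3 by force
  \<comment> \<open>The extra 1 in \<open>A\<close> leaves room for the \<open>- s\<close> in the
    claim. In \<open>C\<close>, the term \<open>A * b\<close> handles \<open>s \<le> b\<close>, and
    \<open>A\<^sup>2 / (4 * B)\<close> is the maximum of
    \<open>A * s - B * s\<^sup>2\<close>.\<close>
  define A where "A = 2 * real m * T' + 1"
  define B where "B = 2 * real m * \<kappa>'"
  have AB: "A \<ge> 0" "B > 0" using b(1) m_ge_3 by (auto simp: A_def B_def T'_def)
  define C where "C = A * b + A\<^sup>2 / (4 * B)"
  have "2 * real m * profile t s \<le> C - s" if t: "\<bar>t\<bar> \<le> T" and s: "0 \<le> s" for t s
  proof -
    have ts: "t * s \<le> T' * s" using t s by (intro mult_right_mono) (auto simp: T'_def)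
    have C1: "A\<^sup>2 / (4 * B) \<ge> 0" "A * b \<ge> 0" using AB b(2) by auto
    show ?thesis
    proof (cases "s \<le> b")
      case True
      have "profile t s \<le> T' * s"
        using ts h_nonneg[OF s, of t] by (simp add: profile_def)
      then have "2 * real m * profile t s \<le> 2 * real m * (T' * s)" by (intro mult_left_mono) auto
      also have "\<dots> = A * s - s" by (simp add: A_def algebra_simps)
      also have "A * s \<le> A * b" using True AB by (intro mult_left_mono) auto
      finally show ?thesis using C1 by (simp add: C_def)
    next
      case False
      then have s1: "1 \<le> s" "b \<le> s" using b(2) by auto
      have "\<kappa>' * s\<^sup>2 \<le> \<kappa>' * s ^ (m - 1)"
        using b(1) s1 m_ge_3 by (intro mult_left_mono power_increasing) auto
      also have "\<dots> \<le> (inv_lap m ^^ Suc (m - 1)) (rhs t) s"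
        using \<kappa>(2)[OF t] rhs_pos s1
        by (intro b(3) rhs_continuous) (auto simp: less_imp_le)
      also have "\<dots> = h t s" using h_eq_rhs[OF s, of t] m_ge_3 by (simp del: funpow.simps)
      finally have "profile t s \<le> T' * s - \<kappa>' * s\<^sup>2" using ts by (simp add: profile_def)
      then have "2 * real m * profile t s \<le> 2 * real m * (T' * s - \<kappa>' * s\<^sup>2)" by (intro mult_left_mono) auto
      also have "\<dots> = A * s - B * s\<^sup>2 - s" by (simp add: A_def B_def algebra_simps)
      also have "A * s - B * s\<^sup>2 \<le> A\<^sup>2 / (4 * B)"
      proof -
        have "0 \<le> (2 * B * s - A)\<^sup>2" by simp
        then have "4 * B * (A * s - B * s\<^sup>2) \<le> A\<^sup>2" by (simp add: power2_eq_square algebra_simps)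
        then show ?thesis using AB by (simp add: le_divide_eq mult.commute)
      qed
      finally show ?thesis using C1 by (simp add: C_def)
    qed
  qed
  then show ?thesis by blast
qed

section \<open>Integrability, continuity and range of the volume\<close>

lemma profile_measurable [measurable]:
  "(\<lambda>x::real^'n. profile t ((norm x)\<^sup>2)) \<in> borel_measurable borel"
  by (intro borel_measurable_continuous_onI profile_continuous_param continuous_intros) auto

definition volume :: "'n::finite itself \<Rightarrow> real \<Rightarrow> real" where
  "volume _ t = (LINT x::real^'n|lborel. exp (2 * real m * profile t ((norm x)\<^sup>2)))"

lemma exp_profile_le_cauchy_weight:
  assumes "2 * real m * profile t ((norm x)\<^sup>2) \<le> C - (norm x)\<^sup>2"
  shows "exp (2 * real m * profile t ((norm x)\<^sup>2)) \<le> exp C * cauchy_weight (x::real^'n)"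
proof -
  have "exp (2 * real m * profile t ((norm x)\<^sup>2)) \<le> exp C * exp (- (norm x)\<^sup>2)"
    using assms by (simp flip: exp_add)
  also have "\<dots> \<le> exp C * cauchy_weight x"
    by (intro mult_left_mono exp_neg_norm_square_le) auto
  finally show ?thesis .
qed

lemma integrable_profile: "integrable lborel (\<lambda>x::real^'n. exp (2 * real m * profile t ((norm x)\<^sup>2)))"
proof -
  obtain C where C: "\<And>s. 0 \<le> s \<Longrightarrow> 2 * real m * profile t s \<le> C - s"
    using profile_decay[of "\<bar>t\<bar>"] by force
  show ?thesis
  proof (rule Bochner_Integration.integrable_bound)
    show "integrable lborel (\<lambda>x::real^'n. exp C * cauchy_weight x)"
      by (intro integrable_mult_right integrable_cauchy_weight)
    show "AE x::real^'n in lborel. norm (exp (2 * real m * profile t ((norm x)\<^sup>2))) \<le> norm (exp C * cauchy_weight x)"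
    proof (rule AE_I2)
      fix x :: "real^'n"
      have "exp (2 * real m * profile t ((norm x)\<^sup>2)) \<le> exp C * cauchy_weight x"
        by (intro exp_profile_le_cauchy_weight C) simp
      then show "norm (exp (2 * real m * profile t ((norm x)\<^sup>2))) \<le> norm (exp C * cauchy_weight x)"
        by (simp add: abs_mult cauchy_weight_nonneg)
    qed
  qed measurable
qed

text \<open>Dominated convergence: a convergent sequence of parameters is bounded, and the decay
  estimate is uniform over bounded parameters.\<close>

lemma volume_continuous: "continuous_on UNIV (volume TYPE('n::finite))"
proof (rule continuous_on_sequentiallyI)
  fix u :: "nat \<Rightarrow> real" and a assume u: "u \<longlonglongrightarrow> a"
  then obtain T where T: "\<And>n. \<bar>u n\<bar> \<le> T"
    using convergent_imp_Bseq[of u] by (auto simp: convergent_def Bseq_def)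
  obtain C where C: "\<And>t s. \<bar>t\<bar> \<le> T \<Longrightarrow> 0 \<le> s \<Longrightarrow> 2 * real m * profile t s \<le> C - s"
    using profile_decay[of T] by blast
  show "(\<lambda>n. volume TYPE('n) (u n)) \<longlonglongrightarrow> volume TYPE('n) a"
    unfolding volume_def
  proof (rule integral_dominated_convergence)
    show "integrable lborel (\<lambda>x::real^'n. exp C * cauchy_weight x)"
      by (intro integrable_mult_right integrable_cauchy_weight)
    show "AE x::real^'n in lborel. norm (exp (2 * real m * profile (u n) ((norm x)\<^sup>2))) \<le> exp C * cauchy_weight x" for n
      by (intro AE_I2) (simp add: exp_profile_le_cauchy_weight[OF C[OF T]])
    have "(\<lambda>n. profile (u n) s) \<longlonglongrightarrow> profile a s" if "0 \<le> s" for s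
    proof -
      have "continuous_on UNIV (\<lambda>t. profile t s)"
        by (intro profile_continuous_param continuous_intros that)
      then show ?thesis using u by (rule continuous_on_tendsto_compose) auto
    qed
    then show "AE x::real^'n in lborel. (\<lambda>n. exp (2 * real m * profile (u n) ((norm x)\<^sup>2)))
        \<longlonglongrightarrow> exp (2 * real m * profile a ((norm x)\<^sup>2))"
      by (auto intro!: tendsto_intros)
  qed measurable
qed

lemma volume_small:
  assumes "0 < v"
  shows "\<exists>t\<le>0. volume TYPE('n::finite) t \<le> v"
proof -
  define G where "G = (LINT x::real^'n|lborel. cauchy_weight x)"
  have G: "G \<ge> 0" unfolding G_def by (intro integral_nonneg_AE) (simp add: cauchy_weight_nonneg)
  \<comment> \<open>Then \<open>G \<le> r * v\<close> and \<open>r \<le> exp r\<close>, so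
    \<open>exp (- r) * G \<le> v\<close>.\<close>
  define r where "r = G / v + 1"
  have r: "r \<ge> 1" using G assms by (simp add: r_def)
  have "2 * real m * profile (- r) s \<le> (- r) - s" if s: "0 \<le> s" for s
  proof -
    have "profile (- r) s \<le> - (r * s + r)" using h_nonneg[OF s, of "- r"] r by (simp add: profile_def)
    then have "2 * real m * profile (- r) s \<le> 2 * real m * (- (r * s + r))" by (intro mult_left_mono) auto
    \<comment> \<open>The second factor is nonpositive, so lowering the coefficient
      \<open>2 * m\<close> to 1 increases the product.\<close>
    also have "\<dots> \<le> 1 * (- (r * s + r))"
    proof (rule mult_right_mono_neg)
      have "0 \<le> r * s" using r s by simp
      then show "- (r * s + r) \<le> 0" using r by linarith
    qed (use m_ge_3 in simp)
    also have "\<dots> \<le> - r - s" using mult_right_mono[OF r s] by simp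
    finally show ?thesis .
  qed
  then have "volume TYPE('n) (- r) \<le> (LINT x::real^'n|lborel. exp (- r) * cauchy_weight x)"
    unfolding volume_def
    by (intro integral_mono integrable_profile integrable_mult_right integrable_cauchy_weight
        exp_profile_le_cauchy_weight) auto
  also have "\<dots> = exp (- r) * G" by (simp add: G_def)
  also have "\<dots> \<le> v"
  proof -
    have "G \<le> r * v" using assms by (simp add: r_def field_simps)
    also have "r \<le> exp r" using exp_ge_add_one_self[of r] by linarith
    then have "r * v \<le> exp r * v" using assms by (intro mult_right_mono) auto
    finally show ?thesis by (simp add: exp_minus field_simps)
  qed
  finally show ?thesis using r by (intro exI[of _ "- r"]) auto
qed

text \<open>If the volume is at most \<open>K\<close>, then \<open>h\<close> is bounded on \<open>[0, 3]\<close> independently of \<open>t\<close>: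
  the right-hand side is at most \<open>(2m - 1)!\<close> on \<open>[0, 1]\<close>, and beyond that the averages are controlled by
  the volume.\<close>

lemma h_bounded_of_volume_le:
  assumes n: "CARD('n::finite) = 2 * m" and t: "0 \<le> t"
    and K: "volume TYPE('n) t \<le> K" "0 \<le> K" and s: "0 \<le> s" "s \<le> 3"
  shows "h t s \<le> fact (2 * m - 1) * K / (real m * unit_ball_vol (2 * real m)) + fact (2 * m - 1)"
    (is "_ \<le> ?M")
proof -
  have m1: "m \<ge> 1" using m_ge_3 by simp
  define K' where "K' = fact (2 * m - 1) * K / (real m * unit_ball_vol (2 * real m))"
  have \<omega>: "real m * unit_ball_vol (2 * real m) > 0" using m1 by simp
  have K': "K' \<ge> 0" unfolding K'_def using K(2) \<omega> by (intro divide_nonneg_pos) auto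
  have "(\<integral>\<^sup>+x. ennreal (rhs t ((norm (x::real^'n))\<^sup>2)) \<partial>lborel)
      = ennreal (LINT x::real^'n|lborel. rhs t ((norm x)\<^sup>2))"
    unfolding rhs_eq
    by (intro nn_integral_eq_integral integrable_mult_right integrable_profile) auto
  also have "(LINT x::real^'n|lborel. rhs t ((norm x)\<^sup>2)) = fact (2 * m - 1) * volume TYPE('n) t"
    unfolding rhs_eq volume_def by simp
  also have "ennreal \<dots> \<le> ennreal (fact (2 * m - 1) * K)"
    using K(1) by (intro ennreal_leI mult_left_mono) auto
  finally have I: "(\<integral>\<^sup>+x. ennreal (rhs t ((norm (x::real^'n))\<^sup>2)) \<partial>lborel) \<le> ennreal (fact (2 * m - 1) * K)" .
  have int: "integral {0..\<sigma>} (\<lambda>\<tau>. \<tau> ^ (m - 1) * rhs t \<tau>) \<le> K'" if "0 \<le> \<sigma>" for \<sigma>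
  proof -
    have "real m * unit_ball_vol (2 * real m) * integral {0..\<sigma>} (\<lambda>\<tau>. \<tau> ^ (m - 1) * rhs t \<tau>)
        \<le> fact (2 * m - 1) * K"
      by (rule radial_integral_bound[OF rhs_continuous _ _ m1 I])
        (use rhs_pos n K that in \<open>auto simp: less_imp_le\<close>)
    then show ?thesis using \<omega> by (simp add: K'_def le_divide_eq mult.commute)
  qed
  have avg: "avg (m - 1) (rhs t) \<sigma> \<le> ?M" if \<sigma>: "0 \<le> \<sigma>" for \<sigma>
  proof (cases "\<sigma> \<le> 1")
    case True
    have "rhs t \<tau> \<le> fact (2 * m - 1)" if "0 \<le> \<tau>" "\<tau> \<le> \<sigma>" for \<tau>
    proof -
      have "t * \<tau> \<le> t * 1" using t that True by (intro mult_left_mono) auto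
      then have "profile t \<tau> \<le> 0" using h_nonneg[OF that(1), of t] t by (simp add: profile_def)
      then have "exp (2 * real m * profile t \<tau>) \<le> 1" by (simp add: mult_nonneg_nonpos)
      then show ?thesis by (simp add: rhs_eq)
    qed
    then have "avg (m - 1) (rhs t) \<sigma> \<le> avg (m - 1) (\<lambda>_. fact (2 * m - 1)) \<sigma>"
      by (intro avg_mono rhs_continuous \<sigma>) auto
    also have "\<dots> \<le> fact (2 * m - 1)"
      using m1 by (simp add: avg_const of_nat_diff divide_le_eq)
    finally show ?thesis using K' by (simp add: K'_def)
  next
    case False
    have c: "continuous_on {0..} (\<lambda>\<tau>. \<tau> ^ (m - 1) * rhs t \<tau>)"
      by (intro continuous_intros rhs_continuous)
    have "avg 0 (\<lambda>\<tau>. \<tau> ^ (m - 1) * rhs t \<tau>) \<sigma> = \<sigma> ^ (m - 1) * avg (m - 1) (rhs t) \<sigma>"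
      by (simp add: avg_def power_mult_distrib mult.assoc mult.left_commute flip: integral_mult_right)
    then have "\<sigma> ^ m * avg (m - 1) (rhs t) \<sigma> = integral {0..\<sigma>} (\<lambda>\<tau>. \<tau> ^ (m - 1) * rhs t \<tau>)"
      using mult_avg_0_eq_integral[OF c \<sigma>] m1 power_minus_mult[of m \<sigma>]
      by (simp add: mult.assoc[symmetric] mult.commute[of \<sigma>])
    also have "\<dots> \<le> K'" by (rule int[OF \<sigma>])
    finally have *: "\<sigma> ^ m * avg (m - 1) (rhs t) \<sigma> \<le> K'" .
    have "0 \<le> avg (m - 1) (rhs t) \<sigma>"
      using avg_mono[of "\<lambda>_. 0" "rhs t" \<sigma> "m - 1"] rhs_continuous \<sigma> rhs_pos by (simp add: less_imp_le)
    then have "1 * avg (m - 1) (rhs t) \<sigma> \<le> \<sigma> ^ m * avg (m - 1) (rhs t) \<sigma>"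
      using False by (intro mult_right_mono) auto
    also note *
    finally show ?thesis by (simp add: K'_def add_increasing2)
  qed
  have M: "0 \<le> ?M" using K' by (simp add: K'_def)
  have "inv_lap m (rhs t) \<sigma> \<le> ?M" if "0 \<le> \<sigma>" "\<sigma> \<le> 3" for \<sigma>
  proof -
    have "avg 0 (avg (m - 1) (rhs t)) \<sigma> \<le> avg 0 (\<lambda>_. ?M) \<sigma>"
      using that avg by (intro avg_mono continuous_on_avg rhs_continuous continuous_on_const) auto
    then have "inv_lap m (rhs t) \<sigma> \<le> \<sigma> / 4 * ?M"
      unfolding inv_lap_def using that by (intro mult_left_mono) (auto simp: avg_const)
    also have "\<dots> \<le> 1 * ?M" using that M by (intro mult_right_mono) auto
    finally show ?thesis by simp
  qed
  \<comment> \<open>The radius 3 is below \<open>4 * m\<close>, so the remaining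
    \<open>m - 1\<close> inverse Laplacians preserve the bound.\<close>
  then have "(inv_lap m ^^ (m - 1)) (inv_lap m (rhs t)) s \<le> ?M"
    using m_ge_3 s M by (intro inv_lap_pow_le_const[where R = 3] continuous_on_inv_lap rhs_continuous) auto
  also have "(inv_lap m ^^ (m - 1)) (inv_lap m (rhs t)) s = (inv_lap m ^^ Suc (m - 1)) (rhs t) s"
    unfolding funpow_Suc_right by simp
  also have "\<dots> = h t s" using h_eq_rhs[OF s(1), of t] m1 by (simp del: funpow.simps)
  finally show ?thesis .
qed

text \<open>If the volume stayed below \<open>K\<close>, then \<open>h \<le> M\<close> with
  \<open>M\<close> independent of \<open>t\<close>, so the profile would be at least
  \<open>t - M\<close> on a fixed ball in the shell 2 \<le> |x|^2 \<le> 3; this ball alone would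
  then contribute more than \<open>K\<close>.\<close>

lemma volume_large:
  assumes n: "CARD('n::finite) = 2 * m" and K: "0 \<le> K"
  shows "\<exists>t\<ge>0. K < volume TYPE('n) t"
proof -
  define M where "M = fact (2 * m - 1) * K / (real m * unit_ball_vol (2 * real m)) + fact (2 * m - 1)"
  have M: "M \<ge> 0"
    unfolding M_def using K by (intro add_nonneg_nonneg divide_nonneg_nonneg mult_nonneg_nonneg) auto
  \<comment> \<open>The ball of radius 1/10 about a point of norm 8/5 has norms between 3/2 and
    17/10, whose squares lie in \<open>{2..3}\<close>.\<close>
  define x0 :: "real^'n" where "x0 = (8/5) *\<^sub>R axis undefined 1"
  have x0: "norm x0 = 8/5" by (simp add: x0_def)
  define A where "A = cball x0 (1/10)"
  have A: "2 \<le> (norm x)\<^sup>2" "(norm x)\<^sup>2 \<le> 3" if "x \<in> A" for x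
  proof -
    have "dist x0 x \<le> 1/10" using that by (simp add: A_def)
    then have *: "3/2 \<le> norm x" "norm x \<le> 17/10"
      using norm_triangle_ineq3[of x0 x] x0 by (auto simp: dist_norm)
    show "2 \<le> (norm x)\<^sup>2" using power_mono[OF *(1), of 2] by (simp add: power2_eq_square)
    show "(norm x)\<^sup>2 \<le> 3" using power_mono[OF *(2), of 2] by (simp add: power2_eq_square)
  qed
  define \<mu> where "\<mu> = measure lborel A"
  have \<mu>: "\<mu> > 0" by (simp add: \<mu>_def A_def content_cball_pos)
  \<comment> \<open>This choice makes \<open>\<mu> * (t - M + 1)\<close> equal to
    \<open>K + \<mu>\<close>, which exceeds \<open>K\<close>.\<close>
  define t where "t = M + K / \<mu>"
  have t: "t \<ge> 0" "t \<ge> M" using M K \<mu> by (auto simp: t_def)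
  have "K < volume TYPE('n) t"
  proof (rule ccontr)
    assume "\<not> ?thesis"
    then have le: "volume TYPE('n) t \<le> K" by simp
    have "t - M + 1 \<le> exp (2 * real m * profile t ((norm x)\<^sup>2))" if "x \<in> A" for x :: "real^'n"
    proof -
      have "h t ((norm x)\<^sup>2) \<le> M"
        unfolding M_def using A[OF that] by (intro h_bounded_of_volume_le[OF n t(1) le K]) auto
      moreover have "t * 2 \<le> t * (norm x)\<^sup>2" using t A[OF that] by (intro mult_left_mono) auto
      ultimately have p: "t - M \<le> profile t ((norm x)\<^sup>2)" using t by (simp add: profile_def)
      have "1 * (t - M) \<le> 2 * real m * profile t ((norm x)\<^sup>2)"
        using p t m_ge_3 by (intro mult_mono) auto
      then have "t - M + 1 \<le> 1 + 2 * real m * profile t ((norm x)\<^sup>2)" by simp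
      also have "\<dots> \<le> exp (2 * real m * profile t ((norm x)\<^sup>2))" by (rule exp_ge_add_one_self)
      finally show ?thesis .
    qed
    then have "(LINT x::real^'n|lborel. indicator A x * (t - M + 1)) \<le> volume TYPE('n) t"
      unfolding volume_def
    proof (intro integral_mono integrable_profile)
      show "integrable lborel (\<lambda>x. indicator A x * (t - M + 1))"
        by (intro integrable_mult_left integrable_real_indicator)
          (simp_all add: A_def emeasure_lborel_cball_finite[simplified])
    qed (auto simp: indicator_def)
    then have "\<mu> * (t - M + 1) \<le> K" using le by (simp add: \<mu>_def A_def)
    moreover have "\<mu> * (t - M + 1) = K + \<mu>" using \<mu> by (simp add: t_def distrib_left)
    ultimately show False using \<mu> by simp
  qed
  with t show ?thesis by blast
qed

text \<open>A spherical solution tends to minus infinity only logarithmically, whereas \<open>profile t\<close> decays at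
  least linearly in \<open>s = |x|\<^sup>2\<close>.\<close>

lemma not_spherical_profile: "\<not> spherical (\<lambda>x::real^'n. profile t ((norm x)\<^sup>2))"
proof
  assume "spherical (\<lambda>x::real^'n. profile t ((norm x)\<^sup>2))"
  then obtain x0 :: "real^'n" and l where l: "l > 0"
    and eq: "\<And>x. profile t ((norm x)\<^sup>2) = ln (2 * l / (1 + l\<^sup>2 * (norm (x - x0))\<^sup>2))"
    unfolding spherical_def spherical_solution_def by metis
  obtain C where C: "\<And>s. 0 \<le> s \<Longrightarrow> 2 * real m * profile t s \<le> C - s"
    using profile_decay[of "\<bar>t\<bar>"] by force
  define \<alpha> where "\<alpha> = 4 * real m * l"
  define \<beta> where "\<beta> = 4 * real m * l * norm x0 + C - 2 * real m * ln (2 * l)"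
  \<comment> \<open>A crude bound replaces the logarithm: 1 + y^2 \<le> (1 + y)^2 \<le> exp (2 y)
    gives ln (1 + y^2) \<le> 2 y. Lower growth linear in \<open>r\<close> already conflicts with
    decay quadratic in \<open>r\<close>.\<close>
  have "r\<^sup>2 \<le> \<alpha> * r + \<beta>" if r: "0 \<le> r" for r
  proof -
    define x :: "real^'n" where "x = r *\<^sub>R axis undefined 1"
    have nx: "norm x = r" using r by (simp add: x_def)
    define y where "y = l * norm (x - x0)"
    have y: "0 \<le> y" using l by (simp add: y_def)
    have yle: "y \<le> l * (r + norm x0)"
      unfolding y_def using norm_triangle_ineq4[of x x0] nx l by (intro mult_left_mono) auto
    have "1 + y\<^sup>2 \<le> (1 + y)\<^sup>2" using y by (simp add: power2_eq_square algebra_simps)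
    also have "\<dots> \<le> (exp y)\<^sup>2" using y by (intro power_mono) auto
    also have "\<dots> = exp (2 * y)" by (simp add: exp_double)
    finally have "1 + y\<^sup>2 \<le> exp (2 * y)" .
    moreover have y1: "0 < 1 + y\<^sup>2" by (simp add: add_pos_nonneg)
    ultimately have "ln (1 + y\<^sup>2) \<le> 2 * y" by (metis ln_exp ln_mono exp_gt_zero)
    moreover have "profile t (r\<^sup>2) = ln (2 * l) - ln (1 + y\<^sup>2)"
      using eq[of x] l y1 by (simp add: nx y_def power_mult_distrib ln_div)
    ultimately have "ln (2 * l) - 2 * (l * (r + norm x0)) \<le> profile t (r\<^sup>2)" using yle by linarith
    then have "2 * real m * (ln (2 * l) - 2 * (l * (r + norm x0))) \<le> 2 * real m * profile t (r\<^sup>2)"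
      by (intro mult_left_mono) auto
    also have "\<dots> \<le> C - r\<^sup>2" by (intro C) simp
    finally show ?thesis by (simp add: \<alpha>_def \<beta>_def algebra_simps)
  qed
  note bound = this
  define r where "r = \<bar>\<alpha>\<bar> + \<bar>\<beta>\<bar> + 1"
  have r: "r \<ge> 1" by (simp add: r_def)
  have "\<alpha> * r + \<beta> < r * r"
  proof -
    have "\<alpha> * r \<le> \<bar>\<alpha>\<bar> * r" using r by (intro mult_right_mono) auto
    moreover have "\<beta> \<le> \<bar>\<beta>\<bar> * r" using mult_left_mono[OF r, of "\<bar>\<beta>\<bar>"] by simp
    moreover have "r * r = \<bar>\<alpha>\<bar> * r + \<bar>\<beta>\<bar> * r + r"
      by (subst (2) r_def) (simp add: algebra_simps)
    ultimately show ?thesis using r by linarith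
  qed
  with bound[of r] r show False by (simp add: power2_eq_square)
qed

lemma solution_of_volume:
  assumes n: "CARD('n::finite) = 2 * m" and "0 < v"
  shows "\<exists>t. volume TYPE('n) t = v"
proof -
  obtain a where a: "a \<le> 0" "volume TYPE('n) a \<le> v" using volume_small[OF assms(2)] by blast
  obtain b where b: "0 \<le> b" "v < volume TYPE('n) b" using volume_large[OF n, of v] assms(2) by auto
  have "\<exists>t. a \<le> t \<and> t \<le> b \<and> volume TYPE('n) t = v"
    using a b by (intro IVT' continuous_on_subset[OF volume_continuous]) auto
  then show ?thesis by blast
qed

end

section \<open>Conformal metrics of constant Q-curvature with prescribed volume\<close>

theorem theorem3:
  fixes m :: nat
  assumes "odd m" and "m \<ge> 3" and "CARD('n::finite) = 2 * m"
  shows "\<exists>Vm::real. sphere_volume TYPE('n) < ennreal Vm \<and>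
    (\<forall>V::real. 0 < V \<and> V \<le> Vm \<longrightarrow>
      (\<exists>u :: real^'n \<Rightarrow> real. smooth u \<and> \<not> spherical u \<and>
        (\<forall>x. neg_laplacian_pow m u x = fact (2 * m - 1) * exp (2 * real m * u x)) \<and>
        has_bochner_integral lborel (\<lambda>x. exp (2 * real m * u x)) V \<and>
        (\<forall>x. Q_curvature m u x = fact (2 * m - 1)) \<and>
        conformal_volume m u = ennreal V))"
proof -
  obtain h where h: "continuous_on (UNIV \<times> {0..}) (\<lambda>(t, s). h t s)"
    "\<forall>t s. 0 \<le> s \<longrightarrow> 0 \<le> h t s \<and>
      h t s = (inv_lap m ^^ m) (\<lambda>\<sigma>. source m t \<sigma> * exp (- (2 * real m) * h t \<sigma>)) s"
    using exists_potential[of m] assms(2) by auto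
  interpret potential_family m h
    using assms(1,2) h by unfold_locales blast+
  have sol: "\<exists>u :: real^'n \<Rightarrow> real. smooth u \<and> \<not> spherical u \<and>
        (\<forall>x. neg_laplacian_pow m u x = fact (2 * m - 1) * exp (2 * real m * u x)) \<and>
        has_bochner_integral lborel (\<lambda>x. exp (2 * real m * u x)) V \<and>
        (\<forall>x. Q_curvature m u x = fact (2 * m - 1)) \<and>
        conformal_volume m u = ennreal V" if "0 < V" for V
  proof -
    obtain t where t: "volume TYPE('n) t = V" using solution_of_volume[OF assms(3) \<open>0 < V\<close>] by blast
    define u :: "real^'n \<Rightarrow> real" where "u x = profile t ((norm x)\<^sup>2)" for x
    have pde: "neg_laplacian_pow m u x = fact (2 * m - 1) * exp (2 * real m * u x)" for x
      using neg_laplacian_pow_profile[OF assms(3), of t] by (simp add: u_def[abs_def])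
    have int: "has_bochner_integral lborel (\<lambda>x. exp (2 * real m * u x)) V"
      using integrable_profile[of t] t by (auto simp: has_bochner_integral_iff u_def volume_def)
    show ?thesis
    proof (intro exI[of _ u] conjI allI pde int)
      show "smooth u" "\<not> spherical u"
        using smooth_profile not_spherical_profile by (simp_all add: u_def[abs_def])
      show "Q_curvature m u x = fact (2 * m - 1)" for x
        by (simp add: Q_curvature_def pde exp_minus field_simps)
      show "conformal_volume m u = ennreal V"
        using int unfolding conformal_volume_def
        by (subst nn_integral_eq_integral) (auto simp: has_bochner_integral_iff)
    qed
  qed
  \<comment> \<open>Every positive volume is attained, so adding 1 to the finite sphere volume is
    one convenient choice of \<open>Vm\<close>.\<close>
  have "sphere_volume TYPE('n) < ennreal (enn2real (sphere_volume TYPE('n)) + 1)"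
    using sphere_volume_finite[where 'n = 'n]
    by (cases "sphere_volume TYPE('n)" rule: ennreal_cases) (auto simp: ennreal_less_iff)
  with sol show ?thesis by (intro exI[of _ "enn2real (sphere_volume TYPE('n)) + 1"]) simp
qed

end
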